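(* If the compact, connected metric graph $\mathcal{G}$ has triameter $T$ and total length $L$, then the second eigenvalue (spectral gap) of the Laplacian on $\mathcal{G}$ with standard conditions at all vertices satisfies $$\lambda_2^{\mathrm{N}}(\mathcal{G}) < \frac{12L}{T^3}.$$
   Context: A compact metric graph $\mathcal{G}=(\mathsf{V},\mathsf{E})$ has finitely many edges, each edge $\mathsf{e}$ being identified with an interval $(0,\ell_{\mathsf{e}})$ of finite length $\ell_{\mathsf{e}}>0$; loops and multiple edges are allowed. The total length $L$ is the sum of all edge lengths, and $\operatorname{dist}$ denotes the path metric on $\mathcal{G}$. The Laplacian with standard vertex conditions acts as $-\frac{d^2}{dx^2}$ on functions that are in $H^2(0,\ell_{\mathsf{e}})$ on each edge, are continuous at every vertex, and whose normal derivatives sum to zero at every vertex. It is self-adjoint with discrete spectrum; on a connected graph its eigenvalues, counted with multiplicity, are $0=\lambda_1^{\mathrm{N}}<\lambda_2^{\mathrm{N}}\leq\dots$. The triameter of $\mathcal{G}$ is $$T:=\max_{x_1,x_2,x_3\in\mathcal{G}}\ \min_{j\neq k}\ \operatorname{dist}(x_j,x_k),$$ where $x_1,x_2,x_3$ range over all points of the metric graph (not only vertices). *)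

theory Defs
  imports
    "HOL-Analysis.Analysis"
    "HOL-Library.Function_Algebras"
    "Graph_Theory.Digraph_Component"
begin

section \<open>Compact metric graphs\<close>

text \<open>
  The combinatorial graph is a finite directed multigraph (loops and parallel edges allowed).
  The orientation of an edge \<open>e\<close> only records its parametrisation by the interval from \<open>0\<close>
  to \<open>len e\<close>: the coordinate \<open>0\<close> sits at \<open>tail G e\<close> and \<open>len e\<close> at \<open>head G e\<close>.
  At least one edge is required: without edges the function space is trivial and there is no
  spectrum.
\<close>

locale compact_metric_graph = fin_digraph G
  for G :: "('v, 'e) pre_digraph" +
  fixes len :: "'e \<Rightarrow> real"
  assumes arcs_nonempty: "arcs G \<noteq> {}"
    and len_pos: "e \<in> arcs G \<Longrightarrow> 0 < len e"

definition total_length :: "('v, 'e) pre_digraph \<Rightarrow> ('e \<Rightarrow> real) \<Rightarrow> real" where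
  "total_length G len = (\<Sum>e\<in>arcs G. len e)"

datatype ('v, 'e) point = Vertex 'v | Inner 'e real

definition points :: "('v, 'e) pre_digraph \<Rightarrow> ('e \<Rightarrow> real) \<Rightarrow> ('v, 'e) point set" where
  "points G len = Vertex ` verts G \<union> {Inner e x | e x. e \<in> arcs G \<and> 0 < x \<and> x < len e}"

text \<open>The point with coordinate \<open>x\<close> in the closed edge \<open>e\<close>.\<close>

definition edge_point ::
  "('v, 'e) pre_digraph \<Rightarrow> ('e \<Rightarrow> real) \<Rightarrow> 'e \<Rightarrow> real \<Rightarrow> ('v, 'e) point" where
  "edge_point G len e x =
     (if x = 0 then Vertex (tail G e)
      else if x = len e then Vertex (head G e)
      else Inner e x)"

text \<open>
  A path is a finite concatenation of segments \<open>(e, s, t)\<close>, each one running inside the closed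
  edge \<open>e\<close> from the coordinate \<open>s\<close> to the coordinate \<open>t\<close>.
\<close>

fun is_path ::
  "('v, 'e) pre_digraph \<Rightarrow> ('e \<Rightarrow> real) \<Rightarrow> ('v, 'e) point \<Rightarrow> ('e \<times> real \<times> real) list
     \<Rightarrow> ('v, 'e) point \<Rightarrow> bool" where
  "is_path G len p [] q \<longleftrightarrow> p \<in> points G len \<and> p = q"
| "is_path G len p ((e, s, t) # ss) q \<longleftrightarrow>
     e \<in> arcs G \<and> s \<in> {0..len e} \<and> t \<in> {0..len e} \<and>
     p = edge_point G len e s \<and> is_path G len (edge_point G len e t) ss q"

definition path_len :: "('e \<times> real \<times> real) list \<Rightarrow> real" where
  "path_len ss = (\<Sum>(e, s, t)\<leftarrow>ss. \<bar>t - s\<bar>)"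

definition graph_dist ::
  "('v, 'e) pre_digraph \<Rightarrow> ('e \<Rightarrow> real) \<Rightarrow> ('v, 'e) point \<Rightarrow> ('v, 'e) point \<Rightarrow> real" where
  "graph_dist G len p q = Inf {path_len ss | ss. is_path G len p ss q}"

text \<open>The maximum over triples of points, written as a supremum.\<close>

definition triameter :: "('v, 'e) pre_digraph \<Rightarrow> ('e \<Rightarrow> real) \<Rightarrow> real" where
  "triameter G len =
     (SUP (x, y, z) \<in> points G len \<times> points G len \<times> points G len.
        Min {graph_dist G len x y, graph_dist G len x z, graph_dist G len y z})"


section \<open>The Laplacian with standard vertex conditions\<close>

text \<open>
  \<open>H2_edge l f f' f''\<close>: the function \<open>f\<close> is (the continuous representative on \<open>[0, l]\<close> of) an
  element of \<open>H\<^sup>2(0, l)\<close>, with weak derivatives \<open>f'\<close> (again the continuous representative) and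
  \<open>f''\<close>. That is, \<open>f\<close> and \<open>f'\<close> are indefinite integrals of \<open>f'\<close> and \<open>f''\<close>, and \<open>f''\<close> is square
  integrable.
\<close>

definition H2_edge ::
  "real \<Rightarrow> (real \<Rightarrow> complex) \<Rightarrow> (real \<Rightarrow> complex) \<Rightarrow> (real \<Rightarrow> complex) \<Rightarrow> bool" where
  "H2_edge l f f' f'' \<longleftrightarrow>
     set_borel_measurable lborel {0..l} f'' \<and>
     set_integrable lborel {0..l} (\<lambda>x. (norm (f'' x))\<^sup>2) \<and>
     (\<forall>x\<in>{0..l}. f' x = f' 0 + (LINT t:{0..x}|lborel. f'' t)) \<and>
     (\<forall>x\<in>{0..l}. f x = f 0 + (LINT t:{0..x}|lborel. f' t))"

text \<open>
  A function on the graph is a family of functions, one for each closed edge. To have equality of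
  such families mean equality of functions on the graph, they are required to vanish off the
  edges.
\<close>

definition supported_on_edges ::
  "('v, 'e) pre_digraph \<Rightarrow> ('e \<Rightarrow> real) \<Rightarrow> ('e \<Rightarrow> real \<Rightarrow> complex) \<Rightarrow> bool" where
  "supported_on_edges G len f \<longleftrightarrow>
     (\<forall>e x. e \<notin> arcs G \<or> x \<notin> {0..len e} \<longrightarrow> f e x = 0)"

definition continuous_at_vertices ::
  "('v, 'e) pre_digraph \<Rightarrow> ('e \<Rightarrow> real) \<Rightarrow> ('e \<Rightarrow> real \<Rightarrow> complex) \<Rightarrow> bool" where
  "continuous_at_vertices G len f \<longleftrightarrow>
     (\<exists>c. \<forall>e\<in>arcs G. f e 0 = c (tail G e) \<and> f e (len e) = c (head G e))"

text \<open>
  The normal derivatives at a vertex are taken in the direction pointing from the vertex into the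
  edge; a loop contributes both of its ends.
\<close>

definition kirchhoff ::
  "('v, 'e) pre_digraph \<Rightarrow> ('e \<Rightarrow> real) \<Rightarrow> ('e \<Rightarrow> real \<Rightarrow> complex) \<Rightarrow> bool" where
  "kirchhoff G len f' \<longleftrightarrow>
     (\<forall>v\<in>verts G.
        (\<Sum>e | e \<in> arcs G \<and> tail G e = v. f' e 0)
      + (\<Sum>e | e \<in> arcs G \<and> head G e = v. - f' e (len e)) = 0)"

text \<open>
  The Laplacian as a relation: \<open>f\<close> is in its domain and its image is (the \<open>L\<^sup>2\<close> class of) \<open>u\<close>.
\<close>

definition laplacian ::
  "('v, 'e) pre_digraph \<Rightarrow> ('e \<Rightarrow> real) \<Rightarrow> ('e \<Rightarrow> real \<Rightarrow> complex)
     \<Rightarrow> ('e \<Rightarrow> real \<Rightarrow> complex) \<Rightarrow> bool" where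
  "laplacian G len f u \<longleftrightarrow>
     supported_on_edges G len f \<and>
     continuous_at_vertices G len f \<and>
     (\<exists>f' f''.
        (\<forall>e\<in>arcs G. H2_edge (len e) (f e) (f' e) (f'' e)) \<and>
        kirchhoff G len f' \<and>
        (\<forall>e\<in>arcs G. AE x in lborel. x \<in> {0<..<len e} \<longrightarrow> u e x = - f'' e x))"


section \<open>Eigenvalues\<close>

definition graph_fun_scale ::
  "complex \<Rightarrow> ('e \<Rightarrow> real \<Rightarrow> complex) \<Rightarrow> 'e \<Rightarrow> real \<Rightarrow> complex" where
  "graph_fun_scale c f = (\<lambda>e x. c * f e x)"

global_interpretation graph_fun: vector_space graph_fun_scale
  by unfold_locales (auto simp: graph_fun_scale_def fun_eq_iff algebra_simps)

text \<open>The operator being self-adjoint, only real eigenvalues are considered.\<close>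

definition eigenspace ::
  "('v, 'e) pre_digraph \<Rightarrow> ('e \<Rightarrow> real) \<Rightarrow> real \<Rightarrow> ('e \<Rightarrow> real \<Rightarrow> complex) set" where
  "eigenspace G len \<mu> = {f. laplacian G len f (graph_fun_scale (of_real \<mu>) f)}"

definition eigenvalues :: "('v, 'e) pre_digraph \<Rightarrow> ('e \<Rightarrow> real) \<Rightarrow> real set" where
  "eigenvalues G len = {\<mu>. \<exists>f\<in>eigenspace G len \<mu>. f \<noteq> 0}"

definition eigenvalue_multiplicity ::
  "('v, 'e) pre_digraph \<Rightarrow> ('e \<Rightarrow> real) \<Rightarrow> real \<Rightarrow> nat" where
  "eigenvalue_multiplicity G len \<mu> = graph_fun.dim (eigenspace G len \<mu>)"

text \<open>
  The \<open>k\<close>-th eigenvalue (\<open>k = 1, 2, \<dots>\<close>) in increasing order, counted with multiplicity: the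
  first eigenvalue up to which the multiplicities add up to at least \<open>k\<close>.
\<close>

definition nth_eigenvalue ::
  "('v, 'e) pre_digraph \<Rightarrow> ('e \<Rightarrow> real) \<Rightarrow> nat \<Rightarrow> real" where
  "nth_eigenvalue G len k =
     Inf {\<mu> \<in> eigenvalues G len.
            k \<le> (\<Sum>\<nu> | \<nu> \<in> eigenvalues G len \<and> \<nu> \<le> \<mu>. eigenvalue_multiplicity G len \<nu>)}"

end

theory Submission
  imports Defs
begin

text \<open>
  Three points at mutual distance almost \<open>T\<close> are the centres of disjoint balls of radius almost
  \<open>T / 2\<close>. The tent \<open>f\<^sub>i = (T / 2 - dist)\<^sub>+\<close> on the \<open>i\<close>-th ball has slope \<open>1\<close>, so its energy is the
  length of the ball, and since the graph is connected it takes every value in between, which gives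
  \<open>\<integral> f\<^sub>i\<^sup>2 \<ge> \<integral>\<^sub>0\<^sup>T\<^sup>/\<^sup>2 t\<^sup>2 dt = T\<^sup>3 / 24\<close>. Each ball has length at least \<open>T / 2\<close> and all three together at
  most \<open>L\<close>, so two of them have length at most \<open>(L - T / 2) / 2 < L / 2\<close>. Their tents have disjoint
  supports and Rayleigh quotients below \<open>24 / T\<^sup>3 * L / 2 = 12 L / T\<^sup>3\<close>, so the second eigenvalue
  lies below that number.

  The last step needs a variational principle, including the existence of a least positive eigenvalue.
  It is reduced to finite dimension. Let \<open>K\<^sup>2 = 12 L / T\<^sup>3\<close> and cut every edge into segments so short
  that solutions of \<open>f'' = - k\<^sup>2 f\<close> with \<open>0 < k \<le> K\<close> are determined by their values at the segment
  ends. Such solutions with common values at the nodes form an eigenfunction exactly if the net flux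
  at every node vanishes: at a vertex this is the Kirchhoff condition, at a cut it is the continuity
  of the derivative (lemmas \<open>eigenvalue_of_flux_eq_0\<close> and \<open>flux_eq_0_of_eigenvalue\<close>). The flux is
  half the gradient of the quadratic form \<open>q\<^sub>k(\<phi>) = \<Sum> p (\<phi> a - \<phi> b)\<^sup>2 - k\<^sup>2 m (\<phi> a\<^sup>2 + \<phi> b\<^sup>2)\<close> over the segments, where
  \<open>p = k / sin (k l)\<close> and \<open>m = tan (k l / 2) / k\<close>.

  The \<open>k\<close> in \<open>[0, K]\<close> for which \<open>q\<^sub>k(\<phi>) \<le> 0\<close> for some nonzero \<open>\<phi>\<close> of mean zero form a compact set.
  It omits \<open>0\<close> since the graph is connected, and its least element is the square root of the least
  positive eigenvalue (\<open>least_critical_frequency\<close>). The node values of the tents show that \<open>K\<close> belongs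
  to the set and is not its least element: \<open>p l\<close> is close to \<open>1\<close>, and \<open>m\<close> is large enough for
  \<open>\<Sum> m (\<phi> a\<^sup>2 + \<phi> b\<^sup>2) \<ge> \<Sum> |\<phi> a\<^sup>3 - \<phi> b\<^sup>3| / 3\<close>, which connectedness bounds from below
  (\<open>form_tent_le\<close>). Finally no eigenvalue is negative and multiplicities are positive and finite,
  so the least positive eigenvalue bounds the second one from above (\<open>second_eigenvalue_le\<close>).
\<close>

section \<open>Weighted networks and their least critical frequency\<close>

text \<open>
  Connectedness is phrased as: every predicate that each segment transports between its ends is
  constant on the nodes. A level set of a function and membership in a set of nodes are predicates of
  this kind.
\<close>

locale network =
  fixes S :: "'s set" and W :: "'w set" and a b :: "'s \<Rightarrow> 'w"
  assumes finite_S: "finite S" and finite_W: "finite W" and S_nonempty: "S \<noteq> {}"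
    and ends_in: "s \<in> S \<Longrightarrow> a s \<in> W" "s \<in> S \<Longrightarrow> b s \<in> W"
    and segments_connect: "\<lbrakk>\<And>s. s \<in> S \<Longrightarrow> P (a s) \<longleftrightarrow> P (b s); u \<in> W; v \<in> W; P u\<rbrakk> \<Longrightarrow> P v"
begin

text \<open>
  Connectedness forces every level strictly between \<open>\<psi> v\<close> and \<open>\<psi> u\<close> to be crossed by some segment;
  otherwise \<open>t \<le> \<psi> w\<close> would be transported along all segments. Hence the intervals spanned by
  \<open>\<psi>\<close> on the segments cover \<open>[\<psi> v, \<psi> u]\<close>, and their lengths add up to at least its length.
\<close>

lemma total_variation:
  fixes \<psi> :: "'w \<Rightarrow> real"
  assumes "u \<in> W" "v \<in> W"
  shows "\<bar>\<psi> u - \<psi> v\<bar> \<le> (\<Sum>s\<in>S. \<bar>\<psi> (a s) - \<psi> (b s)\<bar>)"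
proof -
  have *: "\<psi> u - \<psi> v \<le> (\<Sum>s\<in>S. \<bar>\<psi> (a s) - \<psi> (b s)\<bar>)" if uv: "u \<in> W" "v \<in> W" for u v
  proof (cases "\<psi> v \<le> \<psi> u")
    case True
    define I where "I s = {min (\<psi> (a s)) (\<psi> (b s))..max (\<psi> (a s)) (\<psi> (b s))}" for s
    have "{\<psi> v..\<psi> u} \<subseteq> insert (\<psi> v) (\<Union>s\<in>S. I s)"
    proof
      fix t assume t: "t \<in> {\<psi> v..\<psi> u}"
      show "t \<in> insert (\<psi> v) (\<Union>s\<in>S. I s)"
      proof (rule ccontr)
        assume n: "t \<notin> insert (\<psi> v) (\<Union>s\<in>S. I s)"
        then have "(t \<le> \<psi> (a s)) = (t \<le> \<psi> (b s))" if "s \<in> S" for s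
          using that by (force simp: I_def min_def max_def split: if_splits)
        then have "t \<le> \<psi> v"
          using segments_connect[of "\<lambda>w. t \<le> \<psi> w" u v] uv t by simp
        then show False using t n by simp
      qed
    qed
    then have sub: "{\<psi> v..\<psi> u} \<subseteq> {\<psi> v..\<psi> v} \<union> (\<Union>s\<in>S. I s)" by auto
    have fm: "I s \<in> fmeasurable lborel" for s
      using fmeasurable_cbox(1)[of "min (\<psi> (a s)) (\<psi> (b s))" "max (\<psi> (a s)) (\<psi> (b s))"]
      by (simp add: I_def)
    have UN: "(\<Union>s\<in>S. I s) \<in> fmeasurable lborel"
      using fm finite_S by (intro fmeasurable.finite_UN) auto
    have c: "{\<psi> v..\<psi> v} \<in> fmeasurable lborel"
      using fmeasurable_cbox(1)[of "\<psi> v" "\<psi> v"] by simp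
    have "measure lborel {\<psi> v..\<psi> u} \<le> measure lborel ({\<psi> v..\<psi> v} \<union> (\<Union>s\<in>S. I s))"
      by (rule measure_mono_fmeasurable[OF sub]) (use fmeasurable.Un[OF c UN] in auto)
    also have "\<dots> \<le> measure lborel {\<psi> v..\<psi> v} + measure lborel (\<Union>s\<in>S. I s)"
      by (rule measure_Un_le) (use UN c in auto)
    also have "measure lborel (\<Union>s\<in>S. I s) \<le> (\<Sum>s\<in>S. measure lborel (I s))"
      by (rule measure_UNION_le) (use finite_S fm in \<open>auto simp: I_def\<close>)
    also have "(\<Sum>s\<in>S. measure lborel (I s)) = (\<Sum>s\<in>S. \<bar>\<psi> (a s) - \<psi> (b s)\<bar>)"
      by (rule sum.cong) (auto simp: I_def min_def max_def)
    finally show ?thesis using True by simp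
  next
    case False
    moreover have "0 \<le> (\<Sum>s\<in>S. \<bar>\<psi> (a s) - \<psi> (b s)\<bar>)" by (simp add: sum_nonneg)
    ultimately show ?thesis by linarith
  qed
  show ?thesis using *[OF assms] *[OF assms(2,1)] by linarith
qed

lemma constant_along_segments:
  assumes "\<And>s. s \<in> S \<Longrightarrow> \<phi> (a s) = \<phi> (b s)" "u \<in> W" "v \<in> W"
  shows "\<phi> u = \<phi> v"
  using segments_connect[of "\<lambda>w. \<phi> u = \<phi> w" u v] assms by auto

text \<open>
  \<open>form p c\<close> is the polarised energy \<open>\<Sum> p (\<phi> a - \<phi> b)\<^sup>2 - c (\<phi> a\<^sup>2 + \<phi> b\<^sup>2)\<close> of a weighted
  graph Laplacian with masses at the segment ends, \<open>mean c\<close> is the matching total mass of \<open>\<phi>\<close>, and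
  \<open>flux p c \<phi> w\<close> is the net outflow at the node \<open>w\<close>. A loop contributes to both sums of \<open>flux\<close>.
\<close>

definition form :: "('s \<Rightarrow> real) \<Rightarrow> ('s \<Rightarrow> real) \<Rightarrow> ('w \<Rightarrow> real) \<Rightarrow> ('w \<Rightarrow> real) \<Rightarrow> real" where
  "form p c \<phi> \<psi> = (\<Sum>s\<in>S. p s * (\<phi> (a s) - \<phi> (b s)) * (\<psi> (a s) - \<psi> (b s))
                        - c s * (\<phi> (a s) * \<psi> (a s) + \<phi> (b s) * \<psi> (b s)))"

definition mean :: "('s \<Rightarrow> real) \<Rightarrow> ('w \<Rightarrow> real) \<Rightarrow> real" where
  "mean c \<phi> = (\<Sum>s\<in>S. c s * (\<phi> (a s) + \<phi> (b s)))"

definition flux :: "('s \<Rightarrow> real) \<Rightarrow> ('s \<Rightarrow> real) \<Rightarrow> ('w \<Rightarrow> real) \<Rightarrow> 'w \<Rightarrow> real" where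
  "flux p c \<phi> w =
     (\<Sum>s | s \<in> S \<and> a s = w. p s * (\<phi> (a s) - \<phi> (b s)) - c s * \<phi> (a s)) +
     (\<Sum>s | s \<in> S \<and> b s = w. p s * (\<phi> (b s) - \<phi> (a s)) - c s * \<phi> (b s))"

text \<open>
  Summation by parts: \<open>2 * flux p c \<phi>\<close> is the gradient of \<open>form p c \<phi> \<phi>\<close>.
\<close>

lemma form_eq_flux: "form p c \<phi> \<psi> = (\<Sum>w\<in>W. \<psi> w * flux p c \<phi> w)"
proof -
  have grp: "(\<Sum>w\<in>W. \<psi> w * (\<Sum>s | s \<in> S \<and> g s = w. h s)) = (\<Sum>s\<in>S. \<psi> (g s) * h s)"
    if "g ` S \<subseteq> W" for g h
  proof -
    have "(\<Sum>w\<in>W. \<psi> w * (\<Sum>s | s \<in> S \<and> g s = w. h s)) = (\<Sum>w\<in>W. \<Sum>s | s \<in> S \<and> g s = w. \<psi> (g s) * h s)"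
      by (auto simp: sum_distrib_left intro!: sum.cong)
    also have "\<dots> = (\<Sum>s\<in>S. \<psi> (g s) * h s)"
      using sum.group[OF finite_S finite_W that, of "\<lambda>s. \<psi> (g s) * h s"] by (simp add: conj_commute)
    finally show ?thesis .
  qed
  have "(\<Sum>w\<in>W. \<psi> w * flux p c \<phi> w)
      = (\<Sum>s\<in>S. \<psi> (a s) * (p s * (\<phi> (a s) - \<phi> (b s)) - c s * \<phi> (a s)))
      + (\<Sum>s\<in>S. \<psi> (b s) * (p s * (\<phi> (b s) - \<phi> (a s)) - c s * \<phi> (b s)))"
    unfolding flux_def distrib_left sum.distrib
    using ends_in by (subst (1 2) grp) auto
  also have "\<dots> = form p c \<phi> \<psi>"
    unfolding form_def sum.distrib[symmetric] by (rule sum.cong) (auto simp: algebra_simps)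
  finally show ?thesis by simp
qed

lemma form_commute: "form p c \<phi> \<psi> = form p c \<psi> \<phi>"
  unfolding form_def by (rule sum.cong) (auto simp: algebra_simps)

lemma form_add_scaled:
  "form p c (\<lambda>w. \<phi> w + t * \<psi> w) \<theta> = form p c \<phi> \<theta> + t * form p c \<psi> \<theta>"
  unfolding form_def sum_distrib_left sum.distrib[symmetric]
  by (rule sum.cong) (auto simp: algebra_simps)

lemma form_quadratic:
  "form p c (\<lambda>w. \<phi> w + t * \<psi> w) (\<lambda>w. \<phi> w + t * \<psi> w)
     = form p c \<phi> \<phi> + 2 * t * form p c \<phi> \<psi> + t\<^sup>2 * form p c \<psi> \<psi>"
proof -
  have "form p c (\<lambda>w. \<phi> w + t * \<psi> w) (\<lambda>w. \<phi> w + t * \<psi> w)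
      = form p c \<phi> (\<lambda>w. \<phi> w + t * \<psi> w) + t * form p c \<psi> (\<lambda>w. \<phi> w + t * \<psi> w)"
    by (rule form_add_scaled)
  also have "\<dots> = form p c (\<lambda>w. \<phi> w + t * \<psi> w) \<phi> + t * form p c (\<lambda>w. \<phi> w + t * \<psi> w) \<psi>"
    by (simp add: form_commute)
  also have "\<dots> = form p c \<phi> \<phi> + 2 * t * form p c \<phi> \<psi> + t\<^sup>2 * form p c \<psi> \<psi>"
    unfolding form_add_scaled by (simp add: form_commute[of p c \<psi> \<phi>] algebra_simps power2_eq_square)
  finally show ?thesis .
qed

lemma form_scale: "form p c (\<lambda>w. t * \<phi> w) (\<lambda>w. t * \<phi> w) = t\<^sup>2 * form p c \<phi> \<phi>"
  unfolding form_def sum_distrib_left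
  by (rule sum.cong) (auto simp: algebra_simps power2_eq_square)

lemma form_const: "form p c \<phi> (\<lambda>_. 1) = - mean c \<phi>"
  unfolding form_def mean_def sum_negf[symmetric] by (rule sum.cong) (auto simp: algebra_simps)

lemma mean_add_scaled: "mean c (\<lambda>w. \<phi> w + t * \<psi> w) = mean c \<phi> + t * mean c \<psi>"
  unfolding mean_def sum_distrib_left sum.distrib[symmetric]
  by (rule sum.cong) (auto simp: algebra_simps)

lemma mean_scale: "mean c (\<lambda>w. t * \<phi> w) = t * mean c \<phi>"
  unfolding mean_def sum_distrib_left by (rule sum.cong) (auto simp: algebra_simps)

lemma mean_scale_weight: "mean (\<lambda>s. t * c s) \<phi> = t * mean c \<phi>"
  unfolding mean_def sum_distrib_left by (rule sum.cong) (auto simp: algebra_simps)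

lemma mean_one_pos: "(\<And>s. s \<in> S \<Longrightarrow> 0 < c s) \<Longrightarrow> 0 < mean c (\<lambda>_. 1)"
  unfolding mean_def using finite_S S_nonempty by (intro sum_pos) auto

lemma flux_eq_0D:
  assumes "\<And>w. w \<in> W \<Longrightarrow> flux p c \<phi> w = 0"
  shows "form p c \<phi> \<psi> = 0" "mean c \<phi> = 0"
proof -
  show *: "form p c \<phi> \<psi> = 0" for \<psi> unfolding form_eq_flux by (simp add: assms)
  show "mean c \<phi> = 0" using *[of "\<lambda>_. 1"] by (simp add: form_const)
qed

lemma flux_eq_0I:
  assumes "\<And>\<psi>. form p c \<phi> \<psi> = 0" "w \<in> W"
  shows "flux p c \<phi> w = 0"
proof -
  have "form p c \<phi> (\<lambda>v. if v = w then 1 else 0) = flux p c \<phi> w"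
    unfolding form_eq_flux using finite_W assms(2)
    by (simp add: if_distrib[of "\<lambda>x. x * _"] sum.delta cong: if_cong)
  then show ?thesis using assms(1) by simp
qed

lemma form_neg_nonzero: "form p c \<phi> \<phi> < 0 \<Longrightarrow> \<exists>w\<in>W. \<phi> w \<noteq> 0"
proof (rule ccontr)
  assume n: "form p c \<phi> \<phi> < 0" "\<not> (\<exists>w\<in>W. \<phi> w \<noteq> 0)"
  then have "form p c \<phi> \<phi> = 0" unfolding form_def using ends_in by (intro sum.neutral) auto
  then show False using n by simp
qed

text \<open>
  A null vector \<open>\<phi>\<close> of a form that is nonnegative on mean-zero functions is orthogonal to all
  mean-zero functions, by varying \<open>\<theta> + t \<phi>\<close> in \<open>t\<close>. It is also orthogonal to the constants,
  because pairing with \<open>1\<close> yields the mean. Constants and mean-zero functions span everything.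
\<close>

lemma flux_eq_0_of_minimizer:
  assumes c: "\<And>s. s \<in> S \<Longrightarrow> 0 < c s"
    and nn: "\<And>\<psi>. mean c \<psi> = 0 \<Longrightarrow> 0 \<le> form p c \<psi> \<psi>"
    and m: "mean c \<phi> = 0" and q: "form p c \<phi> \<phi> \<le> 0" and w: "w \<in> W"
  shows "flux p c \<phi> w = 0"
proof (rule flux_eq_0I[OF _ w])
  fix \<psi>
  have q0: "form p c \<phi> \<phi> = 0" using nn[OF m] q by simp
  define d where "d = mean c \<psi> / mean c (\<lambda>_. 1)"
  define \<theta> where "\<theta> = (\<lambda>w. \<psi> w + (- d) * 1)"
  have M1: "mean c (\<lambda>_. 1) > 0" by (rule mean_one_pos[OF c])
  have \<theta>0: "mean c \<theta> = 0" unfolding \<theta>_def mean_add_scaled using M1 by (simp add: d_def)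
  have "form p c \<phi> \<theta> = 0"
  proof (rule ccontr)
    assume nz: "form p c \<phi> \<theta> \<noteq> 0"
    \<comment> \<open>for this \<open>t\<close> the form takes the value \<open>-1\<close> at \<open>\<theta> + t \<phi>\<close>\<close>
    define t where "t = - (form p c \<theta> \<theta> + 1) / (2 * form p c \<phi> \<theta>)"
    have "mean c (\<lambda>w. \<theta> w + t * \<phi> w) = 0" unfolding mean_add_scaled by (simp add: \<theta>0 m)
    from nn[OF this] have "0 \<le> form p c \<theta> \<theta> + 2 * t * form p c \<phi> \<theta>"
      unfolding form_quadratic by (simp add: q0 form_commute[of p c \<theta> \<phi>])
    moreover have "2 * t * form p c \<phi> \<theta> = - (form p c \<theta> \<theta> + 1)" using nz by (simp add: t_def)
    ultimately show False by linarith
  qed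
  moreover have "form p c \<phi> \<theta> = form p c \<phi> \<psi>"
    unfolding \<theta>_def using form_add_scaled[of p c \<psi> "-d" "\<lambda>_. 1" \<phi>] m
    by (simp add: form_commute[of p c _ \<phi>] form_const)
  ultimately show "form p c \<phi> \<psi> = 0" by simp
qed

text \<open>
  Consider the frequencies \<open>k\<close> in \<open>[0, K]\<close> for which some nonzero mean-zero function has
  nonpositive energy. After normalisation the pairs \<open>(k, \<phi>)\<close> form a compact set, so there is a
  least such \<open>k\<close>; the test function at \<open>K\<close> shows that there is one at all. At \<open>k = 0\<close> the energy is
  \<open>\<Sum> p (\<phi> a - \<phi> b)\<^sup>2\<close>, which vanishes only on constants, so the least \<open>k\<close> is positive. The energy at
  that \<open>k\<close> is nonnegative on mean-zero functions: a negative value would persist for slightly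
  smaller frequencies. So its null vector has no flux (\<open>flux_eq_0_of_minimizer\<close>), and \<open>k < K\<close>
  because the energy at \<open>K\<close> does take a negative value. Conversely, a function without flux has mean
  zero and energy zero, so smaller positive frequencies admit none.
\<close>

theorem least_critical_frequency:
  fixes p m :: "real \<Rightarrow> 's \<Rightarrow> real"
  assumes K: "0 < K"
    and cont: "\<And>s. s \<in> S \<Longrightarrow> continuous_on {0..K} (\<lambda>k. p k s)"
      "\<And>s. s \<in> S \<Longrightarrow> continuous_on {0..K} (\<lambda>k. m k s)"
    and pos: "\<And>k s. k \<in> {0..K} \<Longrightarrow> s \<in> S \<Longrightarrow> 0 < p k s"
      "\<And>k s. k \<in> {0..K} \<Longrightarrow> s \<in> S \<Longrightarrow> 0 < m k s"
    and test: "mean (m K) \<phi>\<^sub>0 = 0" "form (p K) (\<lambda>s. K\<^sup>2 * m K s) \<phi>\<^sub>0 \<phi>\<^sub>0 < 0"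
  obtains k \<phi> where "0 < k" "k < K" "\<exists>w\<in>W. \<phi> w \<noteq> 0"
    "\<And>w. w \<in> W \<Longrightarrow> flux (p k) (\<lambda>s. k\<^sup>2 * m k s) \<phi> w = 0"
    "\<And>k' \<phi>'. \<lbrakk>0 < k'; k' < k; \<And>w. w \<in> W \<Longrightarrow> flux (p k') (\<lambda>s. k'\<^sup>2 * m k' s) \<phi>' w = 0\<rbrakk>
       \<Longrightarrow> \<forall>w\<in>W. \<phi>' w = 0"
proof -
  define q where "q k \<phi> = form (p k) (\<lambda>s. k\<^sup>2 * m k s) \<phi> \<phi>" for k \<phi>
  \<comment> \<open>the functions are made zero off \<open>W\<close> so that the cube is compact in the product topology\<close>
  define box where "box = PiE UNIV (\<lambda>w. if w \<in> W then {-1..1::real} else {0})"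
  define X where "X = {x \<in> {0..K} \<times> box. mean (m (fst x)) (snd x) = 0 \<and> q (fst x) (snd x) \<le> 0
                         \<and> (\<Sum>w\<in>W. (snd x w)\<^sup>2) = 1}"
  have "compact box"
  proof -
    have "compactin (product_topology (\<lambda>_. euclidean) UNIV) box"
      unfolding box_def by (subst compactin_PiE) auto
    then show ?thesis by (simp add: euclidean_product_topology)
  qed
  then have cpt: "compact ({0..K} \<times> box)" by (intro compact_Times) auto
  let ?D = "{0..K} \<times> box"
  have cs: "continuous_on ?D (\<lambda>x. snd x w)" for w
    by (rule continuous_on_subset[OF continuous_on_product_then_coordinatewise[OF continuous_on_snd[OF continuous_on_id]]]) auto
  have cp: "continuous_on ?D (\<lambda>x. p (fst x) s)" "continuous_on ?D (\<lambda>x. m (fst x) s)" if "s \<in> S" for s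
    using continuous_on_compose2[OF cont(1)[OF that] continuous_on_fst[OF continuous_on_id], of ?D]
      continuous_on_compose2[OF cont(2)[OF that] continuous_on_fst[OF continuous_on_id], of ?D]
    by auto
  have c1: "continuous_on ?D (\<lambda>x. mean (m (fst x)) (snd x))"
    unfolding mean_def by (intro continuous_intros cs cp) auto
  have c2: "continuous_on ?D (\<lambda>x. q (fst x) (snd x))"
    unfolding q_def form_def by (intro continuous_intros cs cp) auto
  have c3: "continuous_on ?D (\<lambda>x. \<Sum>w\<in>W. (snd x w)\<^sup>2)"
    by (intro continuous_intros cs)
  have "X = (?D \<inter> (\<lambda>x. mean (m (fst x)) (snd x)) -` {0}) \<inter> (?D \<inter> (\<lambda>x. q (fst x) (snd x)) -` {..0})
      \<inter> (?D \<inter> (\<lambda>x. \<Sum>w\<in>W. (snd x w)\<^sup>2) -` {1})" unfolding X_def by auto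
  then have "closedin (top_of_set ?D) X"
    using c1 c2 c3 by (auto intro!: closedin_Int continuous_closedin_preimage)
  then have "compact X" by (rule closedin_compact[OF cpt])
  have X_I: "\<exists>\<psi>. (k, \<psi>) \<in> X" if k: "k \<in> {0..K}" and \<phi>: "mean (m k) \<phi> = 0" "q k \<phi> \<le> 0" "\<exists>w\<in>W. \<phi> w \<noteq> 0" for k \<phi>
  proof -
    define N where "N = (\<Sum>w\<in>W. (\<phi> w)\<^sup>2)"
    have le: "(\<phi> w)\<^sup>2 \<le> N" if "w \<in> W" for w
      unfolding N_def using finite_W that by (intro member_le_sum) auto
    have N: "N > 0" using le \<phi>(3) by (metis order_less_le_trans zero_less_power2)
    define \<psi> where "\<psi> w = (if w \<in> W then (1 / sqrt N) * \<phi> w else 0)" for w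
    have cong: "form P c \<psi> \<psi> = form P c (\<lambda>w. (1 / sqrt N) * \<phi> w) (\<lambda>w. (1 / sqrt N) * \<phi> w)"
      "mean c \<psi> = mean c (\<lambda>w. (1 / sqrt N) * \<phi> w)" for P c
      unfolding form_def mean_def \<psi>_def using ends_in by (auto intro!: sum.cong)
    have "(\<psi> w)\<^sup>2 \<le> 1" if "w \<in> W" for w
      unfolding \<psi>_def using le[OF that] that N by (simp add: power_mult_distrib power_divide field_simps)
    then have "\<psi> w \<in> {-1..1}" if "w \<in> W" for w
      using that abs_square_le_1[of "\<psi> w"] by (simp add: abs_le_iff)
    then have "\<psi> \<in> box" unfolding box_def by (auto simp: PiE_def Pi_def \<psi>_def)
    moreover have "(\<Sum>w\<in>W. (\<psi> w)\<^sup>2) = 1"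
    proof -
      have "(\<Sum>w\<in>W. (\<psi> w)\<^sup>2) = (\<Sum>w\<in>W. (\<phi> w)\<^sup>2 / N)"
        using N by (intro sum.cong) (auto simp: \<psi>_def power_mult_distrib power_divide)
      also have "\<dots> = 1" using N by (simp add: sum_divide_distrib[symmetric] N_def)
      finally show ?thesis .
    qed
    moreover have "mean (m k) \<psi> = 0" unfolding cong mean_scale using \<phi> by simp
    moreover have "q k \<psi> \<le> 0"
      unfolding q_def cong form_scale
      by (rule mult_nonneg_nonpos[OF zero_le_power2 \<phi>(2)[unfolded q_def]])
    ultimately show ?thesis unfolding X_def using k by auto
  qed
  obtain x\<^sub>0 where "x\<^sub>0 \<in> X"
    using X_I[of K \<phi>\<^sub>0] test form_neg_nonzero[OF test(2)] K by (auto simp: q_def)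
  then have ne: "X \<noteq> {}" by auto
  obtain x where x: "x \<in> X" and min: "\<And>y. y \<in> X \<Longrightarrow> fst x \<le> fst y"
    using continuous_attains_inf[OF \<open>compact X\<close> ne continuous_on_fst[OF continuous_on_id]] by auto
  obtain k \<phi> where kp: "x = (k, \<phi>)" by (cases x)
  have k: "k \<in> {0..K}" and m0: "mean (m k) \<phi> = 0" and q0: "q k \<phi> \<le> 0" and n1: "(\<Sum>w\<in>W. (\<phi> w)\<^sup>2) = 1"
    using x unfolding kp X_def by auto
  have nz: "\<exists>w\<in>W. \<phi> w \<noteq> 0"
  proof (rule ccontr)
    assume "\<not> (\<exists>w\<in>W. \<phi> w \<noteq> 0)" then have "(\<Sum>w\<in>W. (\<phi> w)\<^sup>2) = 0" by (intro sum.neutral) auto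
    then show False using n1 by simp
  qed
  have "k \<noteq> 0"
  proof
    assume "k = 0"
    have "(\<Sum>s\<in>S. p 0 s * (\<phi> (a s) - \<phi> (b s))\<^sup>2) \<le> 0"
      using q0 unfolding q_def form_def \<open>k = 0\<close> by (simp add: power2_eq_square mult.assoc)
    moreover have pp: "0 \<le> p 0 s * (\<phi> (a s) - \<phi> (b s))\<^sup>2" if "s \<in> S" for s
      using pos(1)[of 0 s] K that by simp
    ultimately have "(\<Sum>s\<in>S. p 0 s * (\<phi> (a s) - \<phi> (b s))\<^sup>2) = 0"
      using sum_nonneg[of S "\<lambda>s. p 0 s * (\<phi> (a s) - \<phi> (b s))\<^sup>2", OF pp] by (intro antisym)
    then have "p 0 s * (\<phi> (a s) - \<phi> (b s))\<^sup>2 = 0" if "s \<in> S" for s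
      using sum_nonneg_eq_0_iff[OF finite_S pp] that by auto
    then have eq: "\<phi> (a s) = \<phi> (b s)" if "s \<in> S" for s
      using pos(1)[of 0 s] K that by fastforce
    obtain s\<^sub>0 where s\<^sub>0: "s\<^sub>0 \<in> S" using S_nonempty by auto
    define d where "d = \<phi> (a s\<^sub>0)"
    have all: "\<phi> w = d" if "w \<in> W" for w
      unfolding d_def using constant_along_segments[of \<phi>, OF eq that ends_in(1)[OF s\<^sub>0]] by simp
    have "mean (m 0) \<phi> = d * mean (m 0) (\<lambda>_. 1)"
      unfolding mean_def sum_distrib_left by (rule sum.cong) (auto simp: all ends_in)
    then have "d = 0" using m0 mean_one_pos[of "m 0"] pos(2)[of 0] K \<open>k = 0\<close> by force
    then show False using all nz by auto
  qed
  then have k0: "0 < k" using k by simp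
  have nonneg: "0 \<le> q k \<psi>" if \<psi>: "mean (m k) \<psi> = 0" for \<psi>
  proof (rule ccontr)
    assume neg: "\<not> 0 \<le> q k \<psi>"
    \<comment> \<open>subtracting the constant \<open>d\<close> restores mean zero with respect to the masses at \<open>k\'\<close>\<close>
    define d where "d k' = mean (m k') \<psi> / mean (m k') (\<lambda>_. 1)" for k'
    define h where "h k' = q k' (\<lambda>w. \<psi> w + (- d k') * 1)" for k'
    have M: "mean (m k') (\<lambda>_. 1) > 0" if "k' \<in> {0..K}" for k'
      using mean_one_pos pos(2) that by blast
    have cm: "continuous_on {0..K} (\<lambda>k'. mean (m k') \<phi>)" for \<phi>
      unfolding mean_def by (intro continuous_intros cont) auto
    have "continuous_on {0..K} d"
      unfolding d_def using M by (intro continuous_on_divide cm ballI) force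
    then have ch: "continuous_on {0..K} h"
      unfolding h_def q_def form_def by (intro continuous_intros cont) auto
    have "d k = 0" using \<psi> by (simp add: d_def)
    then have "h k < 0" using neg by (simp add: h_def)
    have "(h \<longlongrightarrow> h k) (at k within {0..K})"
      using ch k by (auto simp: continuous_on_def)
    then have "eventually (\<lambda>k'. h k' < 0) (at k within {0..K})"
      using \<open>h k < 0\<close> by (rule order_tendstoD(2))
    then obtain \<epsilon> where \<epsilon>: "\<epsilon> > 0" "\<And>k'. k' \<in> {0..K} \<Longrightarrow> k' \<noteq> k \<Longrightarrow> dist k' k < \<epsilon> \<Longrightarrow> h k' < 0"
      unfolding eventually_at by auto
    define k' where "k' = max (k / 2) (k - \<epsilon> / 2)"
    have k': "k' \<in> {0..K}" "k' < k" "dist k' k < \<epsilon>"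
      using k0 k \<epsilon>(1) by (auto simp: k'_def dist_real_def)
    have hk: "h k' < 0" using \<epsilon>(2) k' by auto
    have "mean (m k') (\<lambda>w. \<psi> w + (- d k') * 1) = 0"
      unfolding mean_add_scaled using M[OF k'(1)] by (simp add: d_def)
    then obtain \<theta> where "(k', \<theta>) \<in> X"
      using X_I[OF k'(1), of "\<lambda>w. \<psi> w + (- d k') * 1"] hk
        form_neg_nonzero[of "p k'" "\<lambda>s. k'\<^sup>2 * m k' s" "\<lambda>w. \<psi> w + (- d k') * 1"]
      by (auto simp: h_def q_def)
    from min[OF this] show False using k' kp by simp
  qed
  have scaled: "mean (\<lambda>s. k\<^sup>2 * m k s) \<psi> = 0 \<longleftrightarrow> mean (m k) \<psi> = 0" for \<psi>
    using k0 by (simp add: mean_scale_weight)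
  show thesis
  proof (rule that)
    show "0 < k" by (rule k0)
    show "k < K"
      using k nonneg[of \<phi>\<^sub>0] test by (cases "k = K") (auto simp: q_def)
    show "\<exists>w\<in>W. \<phi> w \<noteq> 0" by (rule nz)
    show "flux (p k) (\<lambda>s. k\<^sup>2 * m k s) \<phi> w = 0" if "w \<in> W" for w
      by (rule flux_eq_0_of_minimizer[OF _ _ _ _ that])
        (use k k0 pos(2)[of k] nonneg m0 q0 in \<open>auto simp: scaled q_def\<close>)
    show "\<forall>w\<in>W. \<phi>' w = 0"
      if k': "0 < k'" "k' < k" and fl: "\<And>w. w \<in> W \<Longrightarrow> flux (p k') (\<lambda>s. k'\<^sup>2 * m k' s) \<phi>' w = 0" for k' \<phi>'
    proof (rule ccontr)
      assume "\<not> (\<forall>w\<in>W. \<phi>' w = 0)"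
      moreover have "mean (m k') \<phi>' = 0"
        using flux_eq_0D(2)[of "p k'" "\<lambda>s. k'\<^sup>2 * m k' s" \<phi>', OF fl] k' by (simp add: mean_scale_weight)
      moreover have "q k' \<phi>' \<le> 0"
        using flux_eq_0D(1)[of "p k'" "\<lambda>s. k'\<^sup>2 * m k' s" \<phi>', OF fl] by (simp add: q_def)
      ultimately obtain \<psi> where "(k', \<psi>) \<in> X" using X_I[of k' \<phi>'] k k' by auto
      from min[OF this] show False using k' kp by simp
    qed
  qed
qed

end

section \<open>The path metric and the triameter\<close>

context compact_metric_graph
begin

abbreviation "pt \<equiv> edge_point G len"
abbreviation "dist\<^sub>G \<equiv> graph_dist G len"

lemma pt_0: "pt e 0 = Vertex (tail G e)" by (simp add: edge_point_def)
lemma pt_len: "e \<in> arcs G \<Longrightarrow> pt e (len e) = Vertex (head G e)"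
  using len_pos[of e] by (simp add: edge_point_def)
lemma pt_in_points: "e \<in> arcs G \<Longrightarrow> x \<in> {0..len e} \<Longrightarrow> pt e x \<in> points G len"
  by (auto simp: edge_point_def points_def)

lemma points_cases:
  assumes "p \<in> points G len"
  obtains v where "v \<in> verts G" "p = Vertex v"
  | e x where "e \<in> arcs G" "0 < x" "x < len e" "p = pt e x"
  using assms by (auto simp: points_def edge_point_def)

lemma path_len_simps [simp]:
  "path_len [] = 0" "path_len ((e, s, t) # ss) = \<bar>t - s\<bar> + path_len ss"
  "path_len (ss @ ss') = path_len ss + path_len ss'"
  by (simp_all add: path_len_def)

lemma path_len_nonneg: "0 \<le> path_len ss"
  by (induct ss) auto

lemma is_path_append: "is_path G len p ss q \<Longrightarrow> is_path G len q ss' r \<Longrightarrow> is_path G len p (ss @ ss') r"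
  by (induct ss arbitrary: p) auto

lemma is_path_single:
  "e \<in> arcs G \<Longrightarrow> s \<in> {0..len e} \<Longrightarrow> t \<in> {0..len e} \<Longrightarrow> is_path G len (pt e s) [(e, s, t)] (pt e t)"
  by (simp add: pt_in_points)

lemma is_path_reverse:
  "is_path G len p ss q \<Longrightarrow> \<exists>ss'. is_path G len q ss' p \<and> path_len ss' = path_len ss"
proof (induct ss arbitrary: p)
  case Nil then show ?case by (intro exI[of _ "[]"]) auto
next
  case (Cons x ss)
  obtain e s t where x: "x = (e, s, t)" by (cases x)
  from Cons.prems have e: "e \<in> arcs G" "s \<in> {0..len e}" "t \<in> {0..len e}" "p = pt e s"
    and "is_path G len (pt e t) ss q" by (auto simp: x)
  with Cons.hyps obtain ss' where ss': "is_path G len q ss' (pt e t)" "path_len ss' = path_len ss" by blast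
  have "is_path G len q (ss' @ [(e, t, s)]) p"
    using is_path_append[OF ss'(1) is_path_single[OF e(1,3,2)]] e(4) by simp
  then show ?case using ss'(2) by (intro exI[of _ "ss' @ [(e, t, s)]"]) (auto simp: x)
qed

text \<open>
  Single paths bound a distance from above; lower bounds come from functions that are 1-Lipschitz
  along every edge.
\<close>

lemma path_len_ge_potential:
  assumes "\<And>e s t. e \<in> arcs G \<Longrightarrow> s \<in> {0..len e} \<Longrightarrow> t \<in> {0..len e} \<Longrightarrow> \<bar>F (pt e s) - F (pt e t)\<bar> \<le> \<bar>t - s\<bar>"
    and "is_path G len p ss q"
  shows "\<bar>F p - F q\<bar> \<le> path_len ss"
  using assms(2)
proof (induct ss arbitrary: p)
  case (Cons x ss)
  obtain e s t where x: "x = (e, s, t)" by (cases x)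
  from Cons.prems have e: "e \<in> arcs G" "s \<in> {0..len e}" "t \<in> {0..len e}" "p = pt e s"
    and "is_path G len (pt e t) ss q" by (auto simp: x)
  with Cons.hyps have "\<bar>F (pt e t) - F q\<bar> \<le> path_len ss" by blast
  then show ?case using assms(1)[OF e(1-3)] by (simp add: x e(4))
qed simp

lemma graph_dist_nonneg: "{path_len ss | ss. is_path G len p ss q} \<noteq> {} \<Longrightarrow> 0 \<le> dist\<^sub>G p q"
  unfolding graph_dist_def by (rule cInf_greatest) (auto simp: path_len_nonneg)

lemma graph_dist_le_path_len: "is_path G len p ss q \<Longrightarrow> dist\<^sub>G p q \<le> path_len ss"
  unfolding graph_dist_def by (rule cInf_lower) (auto intro!: bdd_belowI[of _ 0] simp: path_len_nonneg)

lemma graph_dist_pt_le: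
  "e \<in> arcs G \<Longrightarrow> s \<in> {0..len e} \<Longrightarrow> t \<in> {0..len e} \<Longrightarrow> dist\<^sub>G (pt e s) (pt e t) \<le> \<bar>t - s\<bar>"
  using graph_dist_le_path_len[OF is_path_single] by fastforce

lemma graph_dist_commute: "dist\<^sub>G p q = dist\<^sub>G q p"
proof -
  have "{path_len ss | ss. is_path G len p ss q} = {path_len ss | ss. is_path G len q ss p}"
    using is_path_reverse[of p _ q] is_path_reverse[of q _ p] by (intro set_eqI) (simp, metis)
  then show ?thesis by (simp add: graph_dist_def)
qed

lemma graph_dist_self: "p \<in> points G len \<Longrightarrow> dist\<^sub>G p p = 0"
proof -
  assume "p \<in> points G len"
  then have nil: "is_path G len p [] p" by simp
  then have "{path_len ss | ss. is_path G len p ss p} \<noteq> {}" by blast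
  then show ?thesis using graph_dist_nonneg[of p p] graph_dist_le_path_len[OF nil] by simp
qed

end

locale connected_metric_graph = compact_metric_graph G len
  for G :: "('v, 'e) pre_digraph" and len :: "'e \<Rightarrow> real" +
  assumes graph_connected: "Digraph_Component.connected G"
begin

lemma vertices_joined:
  assumes "\<And>e. e \<in> arcs G \<Longrightarrow> P (tail G e) \<longleftrightarrow> P (head G e)" "u \<in> verts G" "v \<in> verts G" "P u"
  shows "P v"
proof -
  interpret sym: pair_wf_digraph "mk_symmetric G" by (rule wellformed_mk_symmetric)
  have "u \<rightarrow>\<^sup>*\<^bsub>mk_symmetric G\<^esub> v"
    using graph_connected assms(2,3) by (auto simp: Digraph_Component.connected_def strongly_connected_def)
  then show "P v"
  proof (induct rule: sym.reachable_induct)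
    case base then show ?case using assms by simp
  next
    case (step x y)
    then show ?case using assms(1) by (auto simp: parcs_mk_symmetric)
  qed
qed

lemma vertex_is_end:
  assumes "v \<in> verts G"
  obtains e where "e \<in> arcs G" "v = tail G e \<or> v = head G e"
proof -
  obtain e where e: "e \<in> arcs G" using arcs_nonempty by auto
  have "\<exists>e\<in>arcs G. v = tail G e \<or> v = head G e"
    by (rule vertices_joined[of _ "tail G e" v]) (use e assms in auto)
  then show thesis using that by blast
qed

lemma path_exists:
  assumes "p \<in> points G len" "q \<in> points G len"
  obtains ss where "is_path G len p ss q"
proof -
  have vv: "\<exists>ss. is_path G len (Vertex u) ss (Vertex v)" if "u \<in> verts G" "v \<in> verts G" for u v
  proof (rule vertices_joined[OF _ that])
    show "\<exists>ss. is_path G len (Vertex u) ss (Vertex u)" using that by (intro exI[of _ "[]"]) (auto simp: points_def)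
    fix e assume e: "e \<in> arcs G"
    have "0 \<in> {0..len e}" "len e \<in> {0..len e}" using len_pos[OF e] by auto
    note p = is_path_single[OF e this] is_path_single[OF e this(2,1)]
    show "(\<exists>ss. is_path G len (Vertex u) ss (Vertex (tail G e)))
       = (\<exists>ss. is_path G len (Vertex u) ss (Vertex (head G e)))"
      using p[unfolded pt_0 pt_len[OF e]] is_path_append[of "Vertex u" _ _ _ "Vertex (head G e)"]
        is_path_append[of "Vertex u" _ _ _ "Vertex (tail G e)"] by metis
  qed
  have vx: "\<exists>v\<in>verts G. \<exists>ss. is_path G len p ss (Vertex v)" if "p \<in> points G len" for p
    using that
  proof (cases rule: points_cases)
    case (1 v) then show ?thesis by (intro bexI[of _ v] exI[of _ "[]"]) (auto simp: points_def)
  next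
    case (2 e x)
    then have "is_path G len p [(e, x, 0)] (Vertex (tail G e))"
      using is_path_single[of e x 0] by (simp add: pt_0)
    then show ?thesis using 2 by (intro bexI[of _ "tail G e"] exI[of _ "[(e, x, 0)]"]) auto
  qed
  obtain u ss1 where u: "u \<in> verts G" "is_path G len p ss1 (Vertex u)" using vx[OF assms(1)] by blast
  obtain v ss2 where v: "v \<in> verts G" "is_path G len q ss2 (Vertex v)" using vx[OF assms(2)] by blast
  obtain ss3 where ss3: "is_path G len (Vertex v) ss3 q" using is_path_reverse[OF v(2)] by blast
  obtain ss where "is_path G len (Vertex u) ss (Vertex v)" using vv[OF u(1) v(1)] by blast
  then show thesis using that is_path_append[OF is_path_append[OF u(2)] ss3] by blast
qed

lemma graph_dist_ge_potential:
  assumes "\<And>e s t. e \<in> arcs G \<Longrightarrow> s \<in> {0..len e} \<Longrightarrow> t \<in> {0..len e} \<Longrightarrow> \<bar>F (pt e s) - F (pt e t)\<bar> \<le> \<bar>t - s\<bar>"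
    and "p \<in> points G len" "q \<in> points G len"
  shows "\<bar>F p - F q\<bar> \<le> dist\<^sub>G p q"
  unfolding graph_dist_def
proof (rule cInf_greatest)
  show "{path_len ss | ss. is_path G len p ss q} \<noteq> {}" using path_exists[OF assms(2,3)] by blast
  fix x assume "x \<in> {path_len ss | ss. is_path G len p ss q}"
  then obtain ss where "x = path_len ss" "is_path G len p ss q" by blast
  then show "\<bar>F p - F q\<bar> \<le> x" using path_len_ge_potential[of F, OF assms(1)] by simp
qed

lemma graph_dist_triangle:
  assumes "p \<in> points G len" "q \<in> points G len" "r \<in> points G len"
  shows "dist\<^sub>G p r \<le> dist\<^sub>G p q + dist\<^sub>G q r"
proof -
  have "dist\<^sub>G p r - path_len ss' \<le> dist\<^sub>G p q" if ss': "is_path G len q ss' r" for ss'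
    unfolding graph_dist_def[of _ _ p q]
  proof (rule cInf_greatest)
    show "{path_len ss | ss. is_path G len p ss q} \<noteq> {}" using path_exists[OF assms(1,2)] by blast
    fix x assume "x \<in> {path_len ss | ss. is_path G len p ss q}"
    then obtain ss where "x = path_len ss" "is_path G len p ss q" by auto
    with graph_dist_le_path_len[OF is_path_append[OF this(2) ss']] show "dist\<^sub>G p r - path_len ss' \<le> x" by simp
  qed
  then have "dist\<^sub>G p r - dist\<^sub>G p q \<le> path_len ss'" if "is_path G len q ss' r" for ss' using that by fastforce
  then have "dist\<^sub>G p r - dist\<^sub>G p q \<le> dist\<^sub>G q r"
    unfolding graph_dist_def[of _ _ q r] using path_exists[OF assms(2,3)] by (intro cInf_greatest) blast+
  then show ?thesis by simp
qed

lemma graph_dist_bounded: "\<exists>D. \<forall>p\<in>points G len. \<forall>q\<in>points G len. dist\<^sub>G p q \<le> D"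
proof -
  obtain e\<^sub>0 where "e\<^sub>0 \<in> arcs G" using arcs_nonempty by auto
  then have v\<^sub>0: "Vertex (tail G e\<^sub>0) \<in> points G len" (is "?o \<in> _") by (auto simp: points_def)
  define D where "D = Max ((\<lambda>v. dist\<^sub>G (Vertex v) ?o) ` verts G)"
  define M where "M = Max (len ` arcs G)"
  have M: "len e \<le> M" if "e \<in> arcs G" for e unfolding M_def using that by (intro Max_ge) auto
  have M0: "0 \<le> M" using M[OF \<open>e\<^sub>0 \<in> arcs G\<close>] len_pos[OF \<open>e\<^sub>0 \<in> arcs G\<close>] by simp
  have D: "dist\<^sub>G (Vertex v) ?o \<le> D" if "v \<in> verts G" for v unfolding D_def using that by (intro Max_ge) auto
  have b: "dist\<^sub>G p ?o \<le> M + D" if "p \<in> points G len" for p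
    using that
  proof (cases rule: points_cases)
    case (1 v) then show ?thesis using D[of v] M0 by simp
  next
    case (2 e x)
    have "dist\<^sub>G p (Vertex (tail G e)) \<le> M"
      using graph_dist_pt_le[of e x 0] 2 M[of e] by (simp add: pt_0)
    moreover have "dist\<^sub>G p ?o \<le> dist\<^sub>G p (Vertex (tail G e)) + dist\<^sub>G (Vertex (tail G e)) ?o"
      using that 2 v\<^sub>0 by (intro graph_dist_triangle) (auto simp: points_def)
    ultimately show ?thesis using D[of "tail G e"] 2 by simp
  qed
  have "dist\<^sub>G p q \<le> 2 * (M + D)" if "p \<in> points G len" "q \<in> points G len" for p q
    using graph_dist_triangle[OF that(1) v\<^sub>0 that(2)] b[OF that(1)] b[OF that(2)] by (simp add: graph_dist_commute[of ?o])
  then show ?thesis by blast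
qed

lemma triples_bdd_above:
  "bdd_above ((\<lambda>(x, y, z). Min {dist\<^sub>G x y, dist\<^sub>G x z, dist\<^sub>G y z})
     ` (points G len \<times> points G len \<times> points G len))"
proof -
  obtain D where D: "\<And>p q. p \<in> points G len \<Longrightarrow> q \<in> points G len \<Longrightarrow> dist\<^sub>G p q \<le> D"
    using graph_dist_bounded by blast
  then show ?thesis by (intro bdd_aboveI2[of _ _ D]) (auto simp: min.coboundedI1)
qed

lemma triameter_approx:
  assumes "t < triameter G len"
  obtains x y z where "x \<in> points G len" "y \<in> points G len" "z \<in> points G len"
    "t < dist\<^sub>G x y" "t < dist\<^sub>G x z" "t < dist\<^sub>G y z"
proof -
  let ?P = "points G len \<times> points G len \<times> points G len"
  obtain e\<^sub>0 where "e\<^sub>0 \<in> arcs G" using arcs_nonempty by auto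
  then have "Vertex (tail G e\<^sub>0) \<in> points G len" by (auto simp: points_def)
  then have ne: "?P \<noteq> {}" by auto
  from less_cSUP_iff[OF ne triples_bdd_above, of t] assms
  obtain u where "u \<in> ?P" "t < (case u of (x, y, z) \<Rightarrow> Min {dist\<^sub>G x y, dist\<^sub>G x z, dist\<^sub>G y z})"
    unfolding triameter_def by blast
  then show thesis using that by (cases u) auto
qed

text \<open>
  Three points that cut one edge into quarters are at least a quarter of it apart: the tent of that
  height around one of them is a 1-Lipschitz function that vanishes at the other two.
\<close>

lemma triameter_pos: "0 < triameter G len"
proof -
  obtain e where e: "e \<in> arcs G" using arcs_nonempty by auto
  define h where "h = len e / 4"
  have h: "0 < h" "len e = 4 * h" using len_pos[OF e] by (auto simp: h_def)
  have far: "h \<le> dist\<^sub>G (pt e c) (pt e c')" if "c \<in> {h..3*h}" "c' \<in> {h..3*h}" "\<bar>c - c'\<bar> \<ge> h" for c c'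
  proof -
    define F where "F p = (case p of Vertex v \<Rightarrow> 0 | Inner e' x \<Rightarrow> if e' = e then max 0 (h - \<bar>x - c\<bar>) else 0)"
      for p :: "('v, 'e) point"
    have Fpt: "F (pt e' x) = (if e' = e then max 0 (h - \<bar>x - c\<bar>) else 0)" if "x \<in> {0..len e'}" for e' x
      using that \<open>c \<in> _\<close> h by (auto simp: F_def edge_point_def)
    have "\<bar>F (pt e c) - F (pt e c')\<bar> \<le> dist\<^sub>G (pt e c) (pt e c')"
    proof (rule graph_dist_ge_potential)
      fix e' s t assume "e' \<in> arcs G" "s \<in> {0..len e'}" "t \<in> {0..len e'}"
      then show "\<bar>F (pt e' s) - F (pt e' t)\<bar> \<le> \<bar>t - s\<bar>"
        using Fpt[of s e'] Fpt[of t e'] by (auto simp: max_def)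
    qed (use that h e in \<open>auto intro!: pt_in_points\<close>)
    moreover have "F (pt e c) = h" "F (pt e c') = 0"
      using Fpt[of c e] Fpt[of c' e] that h by (auto simp: abs_minus_commute)
    ultimately show ?thesis using h by simp
  qed
  have "h \<le> Min {dist\<^sub>G (pt e h) (pt e (2*h)), dist\<^sub>G (pt e h) (pt e (3*h)), dist\<^sub>G (pt e (2*h)) (pt e (3*h))}"
    using far[of h "2*h"] far[of h "3*h"] far[of "2*h" "3*h"] h by simp
  also have "\<dots> \<le> triameter G len"
    unfolding triameter_def
    by (rule cSUP_upper2[OF triples_bdd_above, of "(pt e h, pt e (2*h), pt e (3*h))"])
      (use h e in \<open>auto intro!: pt_in_points\<close>)
  finally show ?thesis using h by simp
qed

end

section \<open>Eigenfunctions on the edges\<close>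

text \<open>
  Regularity: the weak derivative \<open>f''\<close> is integrable, so \<open>f'\<close> and then \<open>f\<close> are continuous. As \<open>f''\<close>
  agrees almost everywhere with the continuous function \<open>- \<mu> f\<close>, the integral equations become
  classical differential equations on the closed edge.
\<close>

lemma H2_edge_eigenfunction_ode:
  fixes f f' f'' :: "real \<Rightarrow> complex"
  assumes l: "0 < l" and H2: "H2_edge l f f' f''"
    and eig: "AE x in lborel. x \<in> {0<..<l} \<longrightarrow> of_real \<mu> * f x = - f'' x"
    and x: "x \<in> {0..l}"
  shows "(f has_vector_derivative f' x) (at x within {0..l})"
    and "(f' has_vector_derivative - of_real \<mu> * f x) (at x within {0..l})"
proof -
  have meas: "set_borel_measurable lborel {0..l} f''"
    and sq: "set_integrable lborel {0..l} (\<lambda>x. (norm (f'' x))\<^sup>2)"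
    and f': "\<And>x. x \<in> {0..l} \<Longrightarrow> f' x = f' 0 + (LINT t:{0..x}|lborel. f'' t)"
    and f: "\<And>x. x \<in> {0..l} \<Longrightarrow> f x = f 0 + (LINT t:{0..x}|lborel. f' t)"
    using H2 unfolding H2_edge_def by blast+
  have "set_integrable lborel {0..l} (\<lambda>x. 1 + (norm (f'' x))\<^sup>2)"
    by (rule set_integral_add(1)[OF _ sq])
      (simp add: set_integrable_def borel_integrable_compact[of "{0..l}" "\<lambda>_. 1 :: real", simplified])
  then have int: "set_integrable lborel {0..l} f''"
    unfolding set_integrable_def
  proof (rule Bochner_Integration.integrable_bound)
    show "(\<lambda>x. indicator {0..l} x *\<^sub>R f'' x) \<in> borel_measurable lborel"
      using meas by (simp add: set_borel_measurable_def)
    \<comment> \<open>this makes square integrable functions integrable on a bounded interval\<close>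
    have "t \<le> 1 + t\<^sup>2" for t :: real using sum_power2_ge_zero[of "t - 1/2" 0] by (simp add: power2_eq_square algebra_simps)
    then show "AE x in lborel. norm (indicator {0..l} x *\<^sub>R f'' x)
        \<le> norm (indicator {0..l} x *\<^sub>R (1 + (norm (f'' x))\<^sup>2))"
      by (intro always_eventually) (auto simp: indicator_def abs_of_nonneg)
  qed
  have sub: "{0..y} \<subseteq> {0..l}" if "y \<in> {0..l}" for y using that by auto
  have int_y: "set_integrable lborel {0..y} f''" if "y \<in> {0..l}" for y
    by (rule set_integrable_subset[OF int _ sub[OF that]]) simp
  have f'_eq: "f' y = f' 0 + integral {0..y} f''" if "y \<in> {0..l}" for y
    using f'[OF that] set_borel_integral_eq_integral(2)[OF int_y[OF that]] by simp
  have "f'' integrable_on {0..l}" by (rule set_borel_integral_eq_integral(1)[OF int])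
  then have "continuous_on {0..l} (\<lambda>y. f' 0 + integral {0..y} f'')"
    by (intro continuous_intros indefinite_integral_continuous_1)
  then have cf': "continuous_on {0..l} f'" by (rule continuous_on_eq) (simp add: f'_eq[symmetric])
  have f_eq: "f y = f 0 + integral {0..y} f'" if "y \<in> {0..l}" for y
  proof -
    have "set_integrable lborel {0..y} f'"
      unfolding set_integrable_def
      by (rule borel_integrable_compact[OF compact_Icc continuous_on_subset[OF cf' sub[OF that]]])
    from set_borel_integral_eq_integral(2)[OF this] f[OF that] show ?thesis by simp
  qed
  have primitive: "(F has_vector_derivative g y) (at y within {0..l})"
    if "continuous_on {0..l} g" "\<And>y. y \<in> {0..l} \<Longrightarrow> F y = F 0 + integral {0..y} g" "y \<in> {0..l}"
    for F g :: "real \<Rightarrow> complex" and y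
  proof (rule has_vector_derivative_transform[OF that(3) that(2)])
    show "((\<lambda>y. F 0 + integral {0..y} g) has_vector_derivative g y) (at y within {0..l})"
      using integral_has_vector_derivative[OF that(1,3)] by (auto intro!: derivative_eq_intros)
  qed
  have df: "(f has_vector_derivative f' y) (at y within {0..l})" if "y \<in> {0..l}" for y
    by (rule primitive[OF cf' f_eq that])
  then show "(f has_vector_derivative f' x) (at x within {0..l})" using x .
  have cf: "continuous_on {0..l} f"
    using df by (rule continuous_on_vector_derivative)
  obtain N where N: "N \<in> null_sets lborel" "{x. \<not> (x \<in> {0<..<l} \<longrightarrow> of_real \<mu> * f x = - f'' x)} \<subseteq> N"
    using eig unfolding eventually_ae_filter by auto
  then have "negligible N" by (simp add: negligible_iff_null_sets null_sets_completionI)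
  then have "negligible (N \<union> {0, l})" by (intro negligible_Un) auto
  then have "integral {0..y} f'' = integral {0..y} (\<lambda>t. - of_real \<mu> * f t)" if "y \<in> {0..l}" for y
  proof (rule integral_spike)
    fix t assume t: "t \<in> {0..y} - (N \<union> {0, l})"
    then have "t \<in> {0<..<l}" using that by auto
    then have "of_real \<mu> * f t = - f'' t" using t N(2) by blast
    then show "- of_real \<mu> * f t = f'' t" by simp
  qed
  then have f'_eq2: "f' y = f' 0 + integral {0..y} (\<lambda>t. - of_real \<mu> * f t)" if "y \<in> {0..l}" for y
    using f'_eq[OF that] that by simp
  have "continuous_on {0..l} (\<lambda>t. - of_real \<mu> * f t)"
    by (intro continuous_intros cf)
  from primitive[OF this f'_eq2 x]
  show "(f' has_vector_derivative - of_real \<mu> * f x) (at x within {0..l})" .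
qed

lemma H2_edge_of_smooth:
  fixes f f' f'' :: "real \<Rightarrow> complex"
  assumes l: "0 \<le> l"
    and "\<And>x. (f has_vector_derivative f' x) (at x)" "\<And>x. (f' has_vector_derivative f'' x) (at x)"
    and cont: "continuous_on UNIV f''"
    and eq: "\<And>x. x \<in> {0..l} \<Longrightarrow> F x = f x"
  shows "H2_edge l F f' f''"
proof -
  have int: "set_integrable lborel {0..l} g" if "continuous_on UNIV g" for g :: "real \<Rightarrow> 'b::euclidean_space"
    unfolding set_integrable_def
    by (rule borel_integrable_compact[OF compact_Icc continuous_on_subset[OF that]]) auto
  have FTC: "h x = h 0 + (LINT t:{0..x}|lborel. g t)"
    if "\<And>x. (h has_vector_derivative g x) (at x)" "continuous_on UNIV g" "x \<in> {0..l}" for h g :: "real \<Rightarrow> complex" and x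
  proof -
    have "(LINT t:{0..x}|lborel. g t) = h x - h 0"
      unfolding set_lebesgue_integral_def
      by (rule integral_FTC_Icc)
        (use that in \<open>auto intro: has_vector_derivative_at_within continuous_on_subset\<close>)
    then show ?thesis by simp
  qed
  have c': "continuous_on UNIV f'" using assms(3) by (intro continuous_on_vector_derivative) auto
  show ?thesis
    unfolding H2_edge_def
  proof (intro conjI ballI)
    show "set_borel_measurable lborel {0..l} f''"
      using int[OF cont] by (auto simp: set_borel_measurable_def set_integrable_def)
    show "set_integrable lborel {0..l} (\<lambda>x. (norm (f'' x))\<^sup>2)"
      by (intro int continuous_intros cont)
    show "f' x = f' 0 + (LINT t:{0..x}|lborel. f'' t)" if "x \<in> {0..l}" for x
      by (rule FTC[OF assms(3) cont that])
    show "F x = F 0 + (LINT t:{0..x}|lborel. f' t)" if "x \<in> {0..l}" for x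
      using FTC[OF assms(2) c' that] eq[OF that] eq[of 0] l by simp
  qed
qed

text \<open>
  Variation of constants: \<open>C\<close> and \<open>D\<close>, obtained by rotating \<open>(k f, f')\<close> back through the angle \<open>k x\<close>, are
  first integrals of \<open>f'' = - k\<^sup>2 f\<close>.
\<close>

lemma harmonic_oscillator:
  fixes f f' :: "real \<Rightarrow> complex"
  assumes k: "0 < k" and l: "0 < l"
    and df: "\<And>x. x \<in> {0..l} \<Longrightarrow> (f has_vector_derivative f' x) (at x within {0..l})"
    and df': "\<And>x. x \<in> {0..l} \<Longrightarrow> (f' has_vector_derivative - of_real (k\<^sup>2) * f x) (at x within {0..l})"
    and x: "x \<in> {0..l}"
  shows "f x = f 0 * of_real (cos (k * x)) + (f' 0 / of_real k) * of_real (sin (k * x))"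
    and "f' x = - f 0 * of_real (k * sin (k * x)) + f' 0 * of_real (cos (k * x))"
proof -
  define C where "C x = f x * of_real (cos (k * x)) - f' x * of_real (sin (k * x) / k)" for x
  define D where "D x = f x * of_real (k * sin (k * x)) + f' x * of_real (cos (k * x))" for x
  have trig: "((\<lambda>x. complex_of_real (cos (k * x))) has_vector_derivative of_real (- k * sin (k * x))) (at x within {0..l})"
    "((\<lambda>x. complex_of_real (sin (k * x) / k)) has_vector_derivative of_real (cos (k * x))) (at x within {0..l})"
    "((\<lambda>x. complex_of_real (k * sin (k * x))) has_vector_derivative of_real (k\<^sup>2 * cos (k * x))) (at x within {0..l})" for x
    using k by (auto intro!: has_vector_derivative_of_real derivative_eq_intros simp: power2_eq_square)
  have "(C has_vector_derivative 0) (at x within {0..l})" if "x \<in> {0..l}" for x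
  proof -
    have "(C has_vector_derivative
       (f x * of_real (- k * sin (k * x)) + f' x * of_real (cos (k * x)))
       - (f' x * of_real (cos (k * x)) + (- of_real (k\<^sup>2) * f x) * of_real (sin (k * x) / k))) (at x within {0..l})"
      unfolding C_def
      by (intro has_vector_derivative_diff has_vector_derivative_mult df df' trig that)
    also have "(f x * of_real (- k * sin (k * x)) + f' x * of_real (cos (k * x)))
       - (f' x * of_real (cos (k * x)) + (- of_real (k\<^sup>2) * f x) * of_real (sin (k * x) / k)) = 0"
      using k by (simp add: power2_eq_square)
    finally show ?thesis .
  qed
  then have C: "C x = C 0"
    by (metis convex_real_interval(5) has_vector_derivative_zero_constant atLeastAtMost_iff l less_imp_le order_refl x)
  have "(D has_vector_derivative 0) (at x within {0..l})" if "x \<in> {0..l}" for x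
  proof -
    have "(D has_vector_derivative
       (f x * of_real (k\<^sup>2 * cos (k * x)) + f' x * of_real (k * sin (k * x)))
       + (f' x * of_real (- k * sin (k * x)) + (- of_real (k\<^sup>2) * f x) * of_real (cos (k * x)))) (at x within {0..l})"
      unfolding D_def
      by (intro has_vector_derivative_add has_vector_derivative_mult df df' trig that)
    also have "(f x * of_real (k\<^sup>2 * cos (k * x)) + f' x * of_real (k * sin (k * x)))
       + (f' x * of_real (- k * sin (k * x)) + (- of_real (k\<^sup>2) * f x) * of_real (cos (k * x))) = 0"
      by simp
    finally show ?thesis .
  qed
  then have D: "D x = D 0" 
    by (metis convex_real_interval(5) has_vector_derivative_zero_constant atLeastAtMost_iff l less_imp_le order_refl x)
  define c s where "c = complex_of_real (cos (k * x))" and "s = complex_of_real (sin (k * x))"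
  have cs: "c * c + s * s = 1"
    unfolding c_def s_def of_real_mult[symmetric] of_real_add[symmetric] by simp
  have f0: "f 0 = f x * c - f' x * s / k" and f'0: "f' 0 = f x * k * s + f' x * c"
    using C D by (auto simp: C_def D_def c_def s_def algebra_simps)
  have "f 0 * c + f' 0 / k * s = f x * (c * c + s * s)"
    "- f 0 * (k * s) + f' 0 * c = f' x * (c * c + s * s)"
    unfolding f0 f'0 using k by (simp_all add: field_simps)
  then show "f x = f 0 * of_real (cos (k * x)) + (f' 0 / of_real k) * of_real (sin (k * x))"
    "f' x = - f 0 * of_real (k * sin (k * x)) + f' 0 * of_real (cos (k * x))"
    unfolding cs by (simp_all add: c_def s_def)
qed

context compact_metric_graph
begin

lemma eigenspaceE:
  assumes "f \<in> eigenspace G len \<mu>"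
  obtains f' where "supported_on_edges G len f" "continuous_at_vertices G len f" "kirchhoff G len f'"
    "\<And>e x. e \<in> arcs G \<Longrightarrow> x \<in> {0..len e} \<Longrightarrow> (f e has_vector_derivative f' e x) (at x within {0..len e})"
    "\<And>e x. e \<in> arcs G \<Longrightarrow> x \<in> {0..len e} \<Longrightarrow>
       (f' e has_vector_derivative - of_real \<mu> * f e x) (at x within {0..len e})"
proof -
  obtain f' f'' where *: "supported_on_edges G len f" "continuous_at_vertices G len f" "kirchhoff G len f'"
    "\<And>e. e \<in> arcs G \<Longrightarrow> H2_edge (len e) (f e) (f' e) (f'' e)"
    "\<And>e. e \<in> arcs G \<Longrightarrow> AE x in lborel. x \<in> {0<..<len e} \<longrightarrow> of_real \<mu> * f e x = - f'' e x"
    using assms unfolding eigenspace_def laplacian_def graph_fun_scale_def by auto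
  show thesis
  proof (rule that[OF *(1-3)])
    fix e x assume e: "e \<in> arcs G" and x: "x \<in> {0..len e}"
    show "(f e has_vector_derivative f' e x) (at x within {0..len e})"
      by (rule H2_edge_eigenfunction_ode(1)[OF len_pos[OF e] *(4)[OF e] *(5)[OF e] x])
    show "(f' e has_vector_derivative - of_real \<mu> * f e x) (at x within {0..len e})"
      by (rule H2_edge_eigenfunction_ode(2)[OF len_pos[OF e] *(4)[OF e] *(5)[OF e] x])
  qed
qed

lemma eigenspace_supported:
  "f \<in> eigenspace G len \<mu> \<Longrightarrow> e \<notin> arcs G \<or> x \<notin> {0..len e} \<Longrightarrow> f e x = 0"
  unfolding eigenspace_def laplacian_def supported_on_edges_def by blast

text \<open>
  The boundary terms of an integration by parts over all edges cancel when the test function is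
  continuous, that is, when its values at the edge ends depend on the vertex only.
\<close>

lemma kirchhoff_sum:
  assumes "kirchhoff G len f'"
  shows "(\<Sum>e\<in>arcs G. c (head G e) * f' e (len e) - c (tail G e) * f' e 0) = 0"
proof -
  have grp: "(\<Sum>v\<in>verts G. c v * (\<Sum>e | e \<in> arcs G \<and> g e = v. h e)) = (\<Sum>e\<in>arcs G. c (g e) * h e)"
    if "g ` arcs G \<subseteq> verts G" for g and h :: "'e \<Rightarrow> complex"
  proof -
    have "(\<Sum>v\<in>verts G. c v * (\<Sum>e | e \<in> arcs G \<and> g e = v. h e))
        = (\<Sum>v\<in>verts G. \<Sum>e | e \<in> arcs G \<and> g e = v. c (g e) * h e)"
      by (auto simp: sum_distrib_left intro!: sum.cong)
    also have "\<dots> = (\<Sum>e\<in>arcs G. c (g e) * h e)"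
      using sum.group[OF finite_arcs finite_verts that, of "\<lambda>s. c (g s) * h s"] by simp
    finally show ?thesis .
  qed
  have "0 = (\<Sum>v\<in>verts G. c v * ((\<Sum>e | e \<in> arcs G \<and> tail G e = v. f' e 0)
      + (\<Sum>e | e \<in> arcs G \<and> head G e = v. - f' e (len e))))"
    using assms unfolding kirchhoff_def by simp
  also have "\<dots> = (\<Sum>e\<in>arcs G. c (tail G e) * f' e 0) + (\<Sum>e\<in>arcs G. c (head G e) * - f' e (len e))"
    unfolding distrib_left sum.distrib by (subst (1 2) grp) auto
  also have "\<dots> = - (\<Sum>e\<in>arcs G. c (head G e) * f' e (len e) - c (tail G e) * f' e 0)"
    by (simp add: sum_subtractf sum_negf)
  finally show ?thesis by simp
qed

text \<open>
  On each edge \<open>h = Re (cnj f * f')\<close> has derivative \<open>D = |f'|\<^sup>2 - \<mu> |f|\<^sup>2 \<ge> 0\<close>, and its increments over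
  the edges add up to zero. So \<open>h\<close> is constant and \<open>D\<close> vanishes: there is no eigenvalue
  \<open>\<mu> < 0\<close>, and for \<open>\<mu> = 0\<close> the eigenfunctions are constant on edges.
\<close>

lemma eigenfunction_nonpos:
  assumes f: "f \<in> eigenspace G len \<mu>" and \<mu>: "\<mu> \<le> 0"
    and e: "e \<in> arcs G" and x: "x \<in> {0..len e}"
  shows "\<mu> * (norm (f e x))\<^sup>2 = 0" "f e x = f e 0"
proof -
  obtain f' where c: "continuous_at_vertices G len f" and kir: "kirchhoff G len f'"
    and df: "\<And>e x. e \<in> arcs G \<Longrightarrow> x \<in> {0..len e} \<Longrightarrow> (f e has_vector_derivative f' e x) (at x within {0..len e})"
    "\<And>e x. e \<in> arcs G \<Longrightarrow> x \<in> {0..len e} \<Longrightarrow>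
       (f' e has_vector_derivative - of_real \<mu> * f e x) (at x within {0..len e})"
    using f by (rule eigenspaceE) blast
  define h where "h e x = Re (cnj (f e x) * f' e x)" for e x
  define D where "D e x = (norm (f' e x))\<^sup>2 - \<mu> * (norm (f e x))\<^sup>2" for e x
  have D0: "0 \<le> D e x" for e x 
    using mult_nonpos_nonneg[OF \<mu> zero_le_power2[of "norm (f e x)"]] zero_le_power2[of "norm (f' e x)"]
    unfolding D_def by linarith
  have dh: "(h e has_real_derivative D e x) (at x within {0..len e})" if "e \<in> arcs G" "x \<in> {0..len e}" for e x
  proof -
    have "((\<lambda>x. cnj (f e x) * f' e x) has_vector_derivative
       cnj (f e x) * (- of_real \<mu> * f e x) + cnj (f' e x) * f' e x) (at x within {0..len e})"
      by (intro has_vector_derivative_mult has_vector_derivative_cnj df that)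
    then have "(h e has_vector_derivative Re (cnj (f e x) * (- of_real \<mu> * f e x) + cnj (f' e x) * f' e x)) (at x within {0..len e})"
      unfolding h_def by (rule bounded_linear.has_vector_derivative[OF bounded_linear_Re])
    moreover have "Re (cnj (f e x) * (- of_real \<mu> * f e x) + cnj (f' e x) * f' e x) = D e x"
      by (simp add: D_def cmod_power2) (simp add: power2_eq_square algebra_simps)
    ultimately show ?thesis by (simp add: has_real_derivative_iff_has_vector_derivative)
  qed
  have mono: "h e x \<le> h e y" if "e \<in> arcs G" "x \<in> {0..len e}" "y \<in> {0..len e}" "x \<le> y" for e x y
  proof -
    have "(h e has_derivative (*) (D e z)) (at z within {x..y})" if "x \<le> z" "z \<le> y" for z
      using dh[of e z] \<open>e \<in> arcs G\<close> \<open>x \<in> _\<close> \<open>y \<in> _\<close> that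
      by (auto simp: has_field_derivative_def intro: has_derivative_subset)
    then obtain z where "h e y - h e x = D e z * (y - x)"
      using mvt_very_simple[OF \<open>x \<le> y\<close>, of "h e" "\<lambda>z. (*) (D e z)"] by auto
    then show ?thesis using mult_nonneg_nonneg[OF D0[of e z], of "y - x"] \<open>x \<le> y\<close> by linarith
  qed
  obtain cv where cv: "\<And>e. e \<in> arcs G \<Longrightarrow> f e 0 = cv (tail G e) \<and> f e (len e) = cv (head G e)"
    using c unfolding continuous_at_vertices_def by blast
  have "(\<Sum>e\<in>arcs G. h e (len e) - h e 0)
      = Re (\<Sum>e\<in>arcs G. cnj (cv (head G e)) * f' e (len e) - cnj (cv (tail G e)) * f' e 0)"
    unfolding Re_sum by (rule sum.cong) (auto simp: h_def cv)
  also have "\<dots> = 0" by (subst kirchhoff_sum[OF kir]) simp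
  finally have sum0: "(\<Sum>e\<in>arcs G. h e (len e) - h e 0) = 0" .
  have nn: "0 \<le> h e (len e) - h e 0" if "e \<in> arcs G" for e
    using mono[of e 0 "len e"] len_pos[OF that] that by simp
  have "h e (len e) - h e 0 = 0"
    using sum_nonneg_eq_0_iff[of "arcs G" "\<lambda>e. h e (len e) - h e 0", OF finite_arcs nn] sum0 e by blast
  then have const: "h e y = h e 0" if "y \<in> {0..len e}" for y
    using mono[OF e, of 0 y] mono[OF e, of y "len e"] that len_pos[OF e] by auto
  have D: "D e y = 0" if y: "y \<in> {0..len e}" for y
  proof (rule vector_derivative_unique_within)
    show "at y within {0..len e} \<noteq> bot" using y len_pos[OF e] by (simp add: trivial_limit_within islimpt_Icc)
    show "(h e has_vector_derivative D e y) (at y within {0..len e})"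
      using dh[OF e y] by (simp add: has_real_derivative_iff_has_vector_derivative)
    show "(h e has_vector_derivative 0) (at y within {0..len e})"
      by (rule has_vector_derivative_transform[OF y const has_vector_derivative_const])
  qed
  have parts: "(norm (f' e y))\<^sup>2 = 0 \<and> \<mu> * (norm (f e y))\<^sup>2 = 0" if "y \<in> {0..len e}" for y
    using D[OF that] \<mu> unfolding D_def
    by (smt (verit) mult_nonpos_nonneg zero_le_power2)
  then show "\<mu> * (norm (f e x))\<^sup>2 = 0" using x by blast
  have "(f e has_vector_derivative 0) (at y within {0..len e})" if "y \<in> {0..len e}" for y
    using df(1)[OF e that] parts[OF that] by simp
  then show "f e x = f e 0"
    by (metis convex_real_interval(5) has_vector_derivative_zero_constant atLeastAtMost_iff len_pos[OF e] less_imp_le order_refl x)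
qed

lemma eigenvalue_nonneg: "\<mu> \<in> eigenvalues G len \<Longrightarrow> 0 \<le> \<mu>"
proof (rule ccontr)
  assume "\<mu> \<in> eigenvalues G len" and neg: "\<not> 0 \<le> \<mu>"
  then obtain f where f: "f \<in> eigenspace G len \<mu>" "f \<noteq> 0" by (auto simp: eigenvalues_def)
  have "f e x = 0" for e x
  proof (cases "e \<in> arcs G \<and> x \<in> {0..len e}")
    case True then show ?thesis using eigenfunction_nonpos(1)[OF f(1), of e x] neg by simp
  next
    case False
    then show ?thesis using eigenspace_supported[OF f(1)] by blast
  qed
  then show False using f(2) by (auto simp: fun_eq_iff)
qed

definition edge_fun :: "'e \<Rightarrow> (real \<Rightarrow> complex) \<Rightarrow> 'e \<Rightarrow> real \<Rightarrow> complex" where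
  "edge_fun e u = (\<lambda>e' x. if e' = e \<and> x \<in> {0..len e} then u x else 0)"

text \<open>
  The dimension of an infinite-dimensional space is \<open>0\<close> by convention, so a nonzero element gives a
  positive dimension only together with a finite spanning set.
\<close>

lemma dim_pos_of_edge_basis:
  assumes V: "\<And>f. f \<in> V \<Longrightarrow> \<exists>A B. \<forall>e x. f e x = (if e \<in> arcs G \<and> x \<in> {0..len e} then A e * u x + B e * v x else 0)"
    and f: "f \<in> V" "f \<noteq> 0"
  shows "1 \<le> graph_fun.dim V"
proof -
  define T where "T = (\<lambda>e. edge_fun e u) ` arcs G \<union> (\<lambda>e. edge_fun e v) ` arcs G"
  have "finite T" by (simp add: T_def)
  have VT: "V \<subseteq> graph_fun.span T"
  proof
    fix g assume "g \<in> V"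
    then obtain A B where g: "\<And>e x. g e x = (if e \<in> arcs G \<and> x \<in> {0..len e} then A e * u x + B e * v x else 0)"
      using V[OF \<open>g \<in> V\<close>] by auto
    have app: "(\<Sum>i\<in>I. F i) e x = (\<Sum>i\<in>I. F i e x)" if "finite I" for I :: "'e set" and F :: "'e \<Rightarrow> 'e \<Rightarrow> real \<Rightarrow> complex" and e x
      using that by (induct I) auto
    have "g = (\<Sum>e\<in>arcs G. graph_fun_scale (A e) (edge_fun e u) + graph_fun_scale (B e) (edge_fun e v))"
    proof (intro ext)
      fix e x
      have "(\<Sum>i\<in>arcs G. graph_fun_scale (A i) (edge_fun i u) + graph_fun_scale (B i) (edge_fun i v)) e x
        = (\<Sum>i\<in>arcs G. if i = e then g e x else 0)"
        unfolding app[OF finite_arcs] by (rule sum.cong) (auto simp: graph_fun_scale_def edge_fun_def g)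
      also have "\<dots> = g e x" by (auto simp: g)
      finally show "g e x = (\<Sum>i\<in>arcs G. graph_fun_scale (A i) (edge_fun i u) + graph_fun_scale (B i) (edge_fun i v)) e x" by simp
    qed
    also have "\<dots> \<in> graph_fun.span T"
      by (intro graph_fun.span_sum graph_fun.span_add graph_fun.span_scale graph_fun.span_base) (auto simp: T_def)
    finally show "g \<in> graph_fun.span T" .
  qed
  obtain B where B: "B \<subseteq> V" "graph_fun.independent B" "V \<subseteq> graph_fun.span B" "card B = graph_fun.dim V"
    by (rule graph_fun.basis_exists)
  have "finite B"
    using graph_fun.independent_span_bound[OF \<open>finite T\<close> B(2) subset_trans[OF B(1) VT]] by (rule conjunct1)
  moreover have "B \<noteq> {}"
  proof
    assume "B = {}"
    then have "f \<in> graph_fun.span {}" using B(3) f(1) by blast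
    then show False using f(2) by simp
  qed
  ultimately have "0 < card B" by (simp add: card_gt_0_iff)
  then show ?thesis by (simp add: B(4))
qed

lemma eigenvalue_multiplicity_pos:
  assumes "\<mu> \<in> eigenvalues G len"
  shows "1 \<le> eigenvalue_multiplicity G len \<mu>"
proof -
  obtain f where f: "f \<in> eigenspace G len \<mu>" "f \<noteq> 0" using assms by (auto simp: eigenvalues_def)
  have \<mu>: "0 \<le> \<mu>" by (rule eigenvalue_nonneg[OF assms])
  have supp: "f e x = 0" if "f \<in> eigenspace G len \<mu>" "e \<notin> arcs G \<or> x \<notin> {0..len e}" for f e x
    using eigenspace_supported[OF that] .
  show ?thesis
  proof (cases "\<mu> = 0")
    case True
    show ?thesis unfolding eigenvalue_multiplicity_def
    proof (rule dim_pos_of_edge_basis[OF _ f, of "\<lambda>_. 1" "\<lambda>_. 0"])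
      fix f assume f: "f \<in> eigenspace G len \<mu>"
      show "\<exists>A B. \<forall>e x. f e x = (if e \<in> arcs G \<and> x \<in> {0..len e} then A e * 1 + B e * 0 else 0)"
      proof (rule exI[of _ "\<lambda>e. f e 0"], rule exI[of _ "\<lambda>_. 0"], intro allI)
        fix e x
        show "f e x = (if e \<in> arcs G \<and> x \<in> {0..len e} then f e 0 * 1 + 0 * 0 else 0)"
        proof (cases "e \<in> arcs G \<and> x \<in> {0..len e}")
          case in_edge: True
          then have "f e x = f e 0" using eigenfunction_nonpos(2)[OF f, of e x] True by blast
          then show ?thesis unfolding if_P[OF in_edge] by (simp only: mult_1_right mult_zero_left add_0_right)
        next
          case False
          then show ?thesis using supp[OF f] by (simp only: if_False) blast
        qed
      qed
    qed
  next
    case False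
    define k where "k = sqrt \<mu>"
    have k: "0 < k" "\<mu> = k\<^sup>2" using \<mu> False by (auto simp: k_def)
    show ?thesis unfolding eigenvalue_multiplicity_def
    proof (rule dim_pos_of_edge_basis[OF _ f, of "\<lambda>x. of_real (cos (k * x))" "\<lambda>x. of_real (sin (k * x))"])
      fix f assume f: "f \<in> eigenspace G len \<mu>"
      obtain f' where df: "\<And>e x. e \<in> arcs G \<Longrightarrow> x \<in> {0..len e} \<Longrightarrow> (f e has_vector_derivative f' e x) (at x within {0..len e})"
        "\<And>e x. e \<in> arcs G \<Longrightarrow> x \<in> {0..len e} \<Longrightarrow>
           (f' e has_vector_derivative - of_real \<mu> * f e x) (at x within {0..len e})"
        using f by (rule eigenspaceE) blast
      show "\<exists>A B. \<forall>e x. f e x = (if e \<in> arcs G \<and> x \<in> {0..len e}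
          then A e * of_real (cos (k * x)) + B e * of_real (sin (k * x)) else 0)"
      proof (rule exI[of _ "\<lambda>e. f e 0"], rule exI[of _ "\<lambda>e. f' e 0 / of_real k"], intro allI)
        fix e x
        show "f e x = (if e \<in> arcs G \<and> x \<in> {0..len e}
            then f e 0 * of_real (cos (k * x)) + f' e 0 / of_real k * of_real (sin (k * x)) else 0)"
        proof (cases "e \<in> arcs G \<and> x \<in> {0..len e}")
          case True
          then have e: "e \<in> arcs G" and x: "x \<in> {0..len e}" by auto
          show ?thesis
            using harmonic_oscillator(1)[OF k(1) len_pos[OF e] df(1)[OF e] df(2)[OF e, unfolded k(2)] x] True
            by (simp only: if_True simp_thms)
        next
          case False
          then show ?thesis using supp[OF f] by (simp only: if_False) blast
        qed
      qed
    qed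
  qed
qed

lemma zero_eigenvalue: "0 \<in> eigenvalues G len"
proof -
  define f where "f = (\<lambda>e x. if e \<in> arcs G \<and> x \<in> {0..len e} then 1 else 0 :: complex)"
  obtain e where e: "e \<in> arcs G" using arcs_nonempty by auto
  have "f e 0 \<noteq> 0" using e len_pos[OF e] by (simp add: f_def)
  then have "f \<noteq> 0" by (auto simp: fun_eq_iff)
  moreover have "laplacian G len f (graph_fun_scale (of_real 0) f)"
    unfolding laplacian_def
  proof (intro conjI exI[of _ "\<lambda>_ _. 0"] ballI)
    show "supported_on_edges G len f" by (auto simp: supported_on_edges_def f_def)
    show "continuous_at_vertices G len f" unfolding continuous_at_vertices_def
      using len_pos by (intro exI[of _ "\<lambda>_. 1"]) (auto simp: f_def less_imp_le)
    show "kirchhoff G len (\<lambda>_ _. 0)" by (simp add: kirchhoff_def)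
    show "H2_edge (len e) (f e) (\<lambda>_. 0) (\<lambda>_. 0)" if "e \<in> arcs G" for e
      by (rule H2_edge_of_smooth[where f = "\<lambda>_. 1"]) (use that len_pos[OF that] in \<open>auto simp: f_def\<close>)
  qed (simp add: graph_fun_scale_def)
  ultimately show ?thesis by (auto simp: eigenvalues_def eigenspace_def)
qed

text \<open>
  The eigenvalues up to the least positive one \<open>\<mu>\<close> are just \<open>0\<close> and \<open>\<mu>\<close>, so their multiplicities
  already add up to \<open>2\<close>.
\<close>

lemma second_eigenvalue_le:
  assumes "\<mu> \<in> eigenvalues G len" "0 < \<mu>"
    and least: "\<And>\<nu>. \<nu> \<in> eigenvalues G len \<Longrightarrow> 0 < \<nu> \<Longrightarrow> \<mu> \<le> \<nu>"
  shows "nth_eigenvalue G len 2 \<le> \<mu>"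
proof -
  have eq: "{\<nu>. \<nu> \<in> eigenvalues G len \<and> \<nu> \<le> \<mu>} = {0, \<mu>}"
  proof (intro equalityI subsetI)
    fix \<nu> assume "\<nu> \<in> {\<nu>. \<nu> \<in> eigenvalues G len \<and> \<nu> \<le> \<mu>}"
    then show "\<nu> \<in> {0, \<mu>}" using least[of \<nu>] eigenvalue_nonneg[of \<nu>] by force
  qed (use assms(1,2) zero_eigenvalue in auto)
  have "2 \<le> (\<Sum>\<nu> | \<nu> \<in> eigenvalues G len \<and> \<nu> \<le> \<mu>. eigenvalue_multiplicity G len \<nu>)"
    unfolding eq using assms(2) eigenvalue_multiplicity_pos[OF assms(1)]
      eigenvalue_multiplicity_pos[OF zero_eigenvalue] by simp
  then show ?thesis
    unfolding nth_eigenvalue_def using assms(1)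
    by (intro cInf_lower) (auto intro!: bdd_belowI[of _ 0] eigenvalue_nonneg)
qed

end

section \<open>Sampling eigenfunctions on a subdivision\<close>

text \<open>
  The quotient \<open>sin (k l) / k\<close>, extended continuously to \<open>k = 0\<close>.
\<close>

definition sin_ratio :: "real \<Rightarrow> real \<Rightarrow> real" where
  "sin_ratio l k = (if k = 0 then l else sin (k * l) / k)"

lemma continuous_sin_ratio: "continuous_on A (sin_ratio l)"
proof -
  have "isCont (sin_ratio l) k" for k
  proof (cases "k = 0")
    case True
    have "((\<lambda>k. sin (k * l)) has_real_derivative l) (at 0)"
      by (auto intro!: derivative_eq_intros)
    then have "((\<lambda>k. sin (k * l) / k) \<longlongrightarrow> l) (at 0)"
      by (simp add: has_field_derivative_iff)
    then have "(sin_ratio l \<longlongrightarrow> l) (at 0)"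
      by (rule Lim_transform_eventually) (auto simp: sin_ratio_def eventually_at_filter)
    then show ?thesis using True by (simp add: isCont_def sin_ratio_def)
  next
    case False
    have c: "isCont (\<lambda>k. sin (k * l) / k) k" using False by (intro continuous_intros) auto
    have "eventually (\<lambda>k. k \<noteq> 0) (nhds k)" using False by (intro t1_space_nhds)
    then have ev: "eventually (\<lambda>k. sin_ratio l k = sin (k * l) / k) (nhds k)"
      by (rule eventually_mono) (simp add: sin_ratio_def)
    show ?thesis using isCont_cong[OF ev] c by simp
  qed
  then show ?thesis by (simp add: continuous_at_imp_continuous_on)
qed

text \<open>
  Where the cosine is positive, this is \<open>x \<le> tan x\<close>.
\<close>

lemma mult_cos_le_sin:
  fixes x :: real
  assumes "0 \<le> x" "x \<le> pi"
  shows "x * cos x \<le> sin x"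
proof -
  have "sin 0 - 0 * cos 0 \<le> sin x - x * cos x"
  proof (rule DERIV_nonneg_imp_nondecreasing[OF assms(1)])
    fix y assume y: "0 \<le> y" "y \<le> x"
    have "((\<lambda>y. sin y - y * cos y) has_real_derivative y * sin y) (at y)"
      by (auto intro!: derivative_eq_intros)
    moreover have "0 \<le> y * sin y" using y assms by (simp add: sin_ge_zero)
    ultimately show "\<exists>d. ((\<lambda>y. sin y - y * cos y) has_real_derivative d) (at y) \<and> 0 \<le> d" by blast
  qed
  then show ?thesis by simp
qed

lemma sin_ratio_pos:
  assumes "0 < l" "0 \<le> k" "k * l \<le> 1"
  shows "0 < sin_ratio l k"
  using assms pi_gt3 by (auto simp: sin_ratio_def intro!: divide_pos_pos sin_gt_zero)

lemma cos_pos_of_le_1: "0 \<le> x \<Longrightarrow> x \<le> 1 \<Longrightarrow> 0 < cos (x::real)"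
  using pi_gt3 by (intro cos_gt_zero_pi) auto

locale subdivided_graph = connected_metric_graph G len
  for G :: "('v, 'e) pre_digraph" and len :: "'e \<Rightarrow> real" +
  fixes n :: nat
  assumes n_pos: "0 < n"
begin

definition node :: "'e \<Rightarrow> nat \<Rightarrow> ('v, 'e) point" where
  "node e i = pt e (real i * len e / real n)"

definition segments :: "('e \<times> nat) set" where "segments = arcs G \<times> {..<n}"
definition nodes :: "('v, 'e) point set" where "nodes = (\<lambda>(e, i). node e i) ` (arcs G \<times> {..n})"
definition seg_start :: "'e \<times> nat \<Rightarrow> ('v, 'e) point" where "seg_start s = node (fst s) (snd s)"
definition seg_end :: "'e \<times> nat \<Rightarrow> ('v, 'e) point" where "seg_end s = node (fst s) (Suc (snd s))"
definition seg_len :: "'e \<times> nat \<Rightarrow> real" where "seg_len s = len (fst s) / real n"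

lemma coordinate_in: "e \<in> arcs G \<Longrightarrow> i \<le> n \<Longrightarrow> real i * len e / real n \<in> {0..len e}"
  using len_pos[of e] n_pos by (auto simp: field_simps)

lemma node_0: "node e 0 = Vertex (tail G e)" by (simp add: node_def pt_0)
lemma node_n: "e \<in> arcs G \<Longrightarrow> node e n = Vertex (head G e)" using n_pos by (simp add: node_def pt_len)

lemma node_inner: "e \<in> arcs G \<Longrightarrow> 0 < i \<Longrightarrow> i < n \<Longrightarrow> node e i = Inner e (real i * len e / real n)"
  using len_pos[of e] by (auto simp: node_def edge_point_def field_simps)

lemma node_in_points: "e \<in> arcs G \<Longrightarrow> i \<le> n \<Longrightarrow> node e i \<in> points G len"
  unfolding node_def by (intro pt_in_points coordinate_in)

lemma nodes_subset_points: "nodes \<subseteq> points G len"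
  by (auto simp: nodes_def node_in_points)

lemma vertex_in_nodes: assumes "v \<in> verts G" shows "Vertex v \<in> nodes"
proof -
  obtain e where e: "e \<in> arcs G" "v = tail G e \<or> v = head G e" by (rule vertex_is_end[OF assms])
  have "node e 0 \<in> nodes" "node e n \<in> nodes" using e(1) by (auto simp: nodes_def)
  then show ?thesis using e(2) by (auto simp: node_0 node_n[OF e(1)])
qed

lemma seg_len_pos: "s \<in> segments \<Longrightarrow> 0 < seg_len s"
  using len_pos n_pos by (auto simp: segments_def seg_len_def)

lemma sum_seg_len: "(\<Sum>s\<in>segments. seg_len s) = total_length G len"
proof -
  have "(\<Sum>s\<in>segments. seg_len s) = (\<Sum>e\<in>arcs G. \<Sum>i<n. len e / real n)"
    unfolding segments_def seg_len_def by (subst sum.cartesian_product, rule sum.cong) auto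
  then show ?thesis using n_pos by (simp add: total_length_def)
qed

lemma edge_constant:
  assumes "\<And>s. s \<in> segments \<Longrightarrow> P (seg_start s) \<longleftrightarrow> P (seg_end s)" "e \<in> arcs G" "i \<le> n"
  shows "P (node e i) \<longleftrightarrow> P (node e 0)"
  using assms(3)
proof (induct i)
  case (Suc i)
  then show ?case using assms(1)[of "(e, i)"] assms(2) by (simp add: segments_def seg_start_def seg_end_def)
qed simp

sublocale network segments nodes seg_start seg_end
proof
  show "finite segments" "finite nodes" by (auto simp: segments_def nodes_def)
  show "segments \<noteq> {}" using arcs_nonempty n_pos by (auto simp: segments_def lessThan_empty_iff)
  show "seg_start s \<in> nodes" "seg_end s \<in> nodes" if "s \<in> segments" for s
    using that by (force simp: segments_def nodes_def seg_start_def seg_end_def)+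
next
  fix P u v
  assume P: "\<And>s. s \<in> segments \<Longrightarrow> P (seg_start s) \<longleftrightarrow> P (seg_end s)"
    and uv: "u \<in> nodes" "v \<in> nodes" "P u"
  have edge: "P (node e i) \<longleftrightarrow> P (node e 0)" if "e \<in> arcs G" "i \<le> n" for e i
    by (rule edge_constant[of P e i]) (use P that in auto)
  have ends: "P (Vertex (tail G e)) \<longleftrightarrow> P (Vertex (head G e))" if "e \<in> arcs G" for e
    using edge[OF that, of n] by (simp add: node_0 node_n that)
  obtain e i where u: "u = node e i" "e \<in> arcs G" "i \<le> n" using uv(1) by (auto simp: nodes_def)
  obtain e' i' where v: "v = node e' i'" "e' \<in> arcs G" "i' \<le> n" using uv(2) by (auto simp: nodes_def)
  have "P (Vertex (tail G e))" using edge[OF u(2,3)] uv(3) u(1) by (simp add: node_0)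
  then have "P (Vertex (tail G e'))"
    by (rule vertices_joined[of "\<lambda>v. P (Vertex v)", OF ends, rotated 3]) (use u v in auto)
  then show "P v" using edge[OF v(2,3)] v(1) by (simp add: node_0)
qed

text \<open>
  Let \<open>h\<close> solve \<open>h'' = - k\<^sup>2 h\<close> on a segment of length \<open>l\<close> with end values \<open>x\<close> and \<open>y\<close>. Its energy
  \<open>\<integral> h'\<^sup>2 - k\<^sup>2 h\<^sup>2\<close> is \<open>p (x - y)\<^sup>2 - k\<^sup>2 m (x\<^sup>2 + y\<^sup>2)\<close> for the stiffness \<open>p = k / sin (k l)\<close> and the
  mass \<open>m = tan (k l / 2) / k\<close>. At \<open>k = 0\<close> these continue to the weights \<open>1 / l\<close> and \<open>l / 2\<close>.
\<close>

definition stiffness :: "real \<Rightarrow> 'e \<times> nat \<Rightarrow> real" where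
  "stiffness k s = 1 / sin_ratio (seg_len s) k"

definition mass :: "real \<Rightarrow> 'e \<times> nat \<Rightarrow> real" where
  "mass k s = sin_ratio (seg_len s / 2) k / cos (k * (seg_len s / 2))"

abbreviation "osc_flux k \<equiv> flux (stiffness k) (\<lambda>s. k\<^sup>2 * mass k s)"

lemma flux_inner:
  assumes e: "e \<in> arcs G" and i: "0 < i" "i < n"
  shows "flux p c \<phi> (node e i) =
     (p (e, i) * (\<phi> (node e i) - \<phi> (node e (Suc i))) - c (e, i) * \<phi> (node e i)) +
     (p (e, i - 1) * (\<phi> (node e i) - \<phi> (node e (i - 1))) - c (e, i - 1) * \<phi> (node e i))"
proof -
  have inj: "node e' j = node e i \<longleftrightarrow> e' = e \<and> j = i" if "e' \<in> arcs G" "j \<le> n" for e' j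
  proof (cases "0 < j \<and> j < n")
    case True
    then show ?thesis using node_inner[OF e i] node_inner[OF that(1), of j] len_pos[OF e] n_pos by auto
  next
    case False
    then have "j = 0 \<or> j = n" using that by auto
    then show ?thesis using node_inner[OF e i] node_0[of e'] node_n[OF that(1)] i by auto
  qed
  have "{s. s \<in> segments \<and> seg_start s = node e i} = {(e, i)}"
    using e i inj by (auto simp: segments_def seg_start_def)
  moreover have "{s. s \<in> segments \<and> seg_end s = node e i} = {(e, i - 1)}"
    using e i inj by (auto simp: segments_def seg_end_def)
  ultimately show ?thesis using i by (simp add: flux_def seg_start_def seg_end_def)
qed

lemma flux_vertex:
  "flux p c \<phi> (Vertex v) =
     (\<Sum>e | e \<in> arcs G \<and> tail G e = v.
        p (e, 0) * (\<phi> (node e 0) - \<phi> (node e 1)) - c (e, 0) * \<phi> (node e 0)) +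
     (\<Sum>e | e \<in> arcs G \<and> head G e = v.
        p (e, n - 1) * (\<phi> (node e n) - \<phi> (node e (n - 1))) - c (e, n - 1) * \<phi> (node e n))"
proof -
  have start: "node e i = Vertex v \<longleftrightarrow> i = 0 \<and> tail G e = v" if "e \<in> arcs G" "i < n" for e i
    using that node_0[of e] node_inner[of e i] by (cases "i = 0") auto
  have final: "node e i = Vertex v \<longleftrightarrow> i = n \<and> head G e = v" if "e \<in> arcs G" "0 < i" "i \<le> n" for e i
    using that node_n[of e] node_inner[of e i] by (cases "i = n") auto
  have "{s. s \<in> segments \<and> seg_start s = Vertex v} = (\<lambda>e. (e, 0)) ` {e. e \<in> arcs G \<and> tail G e = v}"
    using n_pos start by (force simp: segments_def seg_start_def)
  moreover have "{s. s \<in> segments \<and> seg_end s = Vertex v} = (\<lambda>e. (e, n - 1)) ` {e. e \<in> arcs G \<and> head G e = v}"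
    using n_pos final by (force simp: segments_def seg_end_def)
  ultimately show ?thesis
    using n_pos by (simp add: flux_def sum.reindex inj_on_def seg_start_def seg_end_def o_def)
qed

text \<open>
  Both sides are \<open>- h'\<close> at the end with value \<open>x\<close>, the derivative taken into the segment, where \<open>h\<close> is
  the solution of \<open>h'' = - k\<^sup>2 h\<close> with end values \<open>x\<close> and \<open>y\<close>.
\<close>

lemma segment_slope:
  assumes k: "0 < k" and s: "s \<in> segments" and small: "k * seg_len s \<le> 1"
  shows "stiffness k s * (x - y) - k\<^sup>2 * mass k s * x
       = k * (cos (k * seg_len s) * x - y) / sin (k * seg_len s)"
proof -
  define t where "t = k * seg_len s / 2"
  have t: "0 < t" "t \<le> 1" using k seg_len_pos[OF s] small by (auto simp: t_def)
  have c: "0 < cos t" using t by (intro cos_pos_of_le_1) auto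
  have sn: "0 < sin t" using t pi_gt3 by (intro sin_gt_zero) auto
  have kl: "k * seg_len s = 2 * t" by (simp add: t_def)
  have p: "stiffness k s = k / (2 * sin t * cos t)"
    using k by (simp add: stiffness_def sin_ratio_def kl sin_double)
  have c': "k\<^sup>2 * mass k s = k * sin t / cos t"
    using k by (simp add: mass_def sin_ratio_def t_def power2_eq_square)
  show ?thesis
    unfolding p c' kl sin_double cos_double_sin using c sn by (simp add: field_simps power2_eq_square)
qed

context
  fixes k :: real
  assumes k: "0 < k" and small: "\<And>e. e \<in> arcs G \<Longrightarrow> k * (len e / real n) \<le> 1"
begin

lemma sin_step_pos: "e \<in> arcs G \<Longrightarrow> 0 < sin (k * (len e / real n))"
proof -
  assume e: "e \<in> arcs G"
  have "0 < k * (len e / real n)" using k len_pos[OF e] n_pos by simp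
  moreover have "k * (len e / real n) < pi" using small[OF e] pi_gt3 by linarith
  ultimately show ?thesis by (rule sin_gt_zero)
qed

lemma segment_slope':
  assumes "e \<in> arcs G" "i < n"
  shows "stiffness k (e, i) * (x - y) - k\<^sup>2 * mass k (e, i) * x
       = k * (cos (k * (len e / real n)) * x - y) / sin (k * (len e / real n))"
  using segment_slope[OF k, of "(e, i)" x y] small[OF assms(1)] assms
  by (simp add: seg_len_def segments_def)

lemma osc_flux_inner:
  assumes e: "e \<in> arcs G" and i: "0 < i" "i < n"
  shows "osc_flux k \<phi> (node e i) = k * (2 * cos (k * (len e / real n)) * \<phi> (node e i)
       - \<phi> (node e (i + 1)) - \<phi> (node e (i - 1))) / sin (k * (len e / real n))"
proof -
  have "k * (C * x - y) / s + k * (C * x - z) / s = k * (2 * C * x - y - z) / s" for C x y z s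
    by (simp add: add_divide_distrib[symmetric] algebra_simps)
  moreover have "i - 1 < n" using i by simp
  ultimately show ?thesis
    unfolding flux_inner[OF assms] segment_slope'[OF e i(2)] segment_slope'[OF e \<open>i - 1 < n\<close>] by simp
qed

text \<open>
  The values of \<open>A cos (k x) + B sin (k x)\<close> at equidistant points satisfy
  \<open>\<phi>\<^sub>i\<^sub>+\<^sub>1 + \<phi>\<^sub>i\<^sub>-\<^sub>1 = 2 cos (k d) \<phi>\<^sub>i\<close>, which says that no flux leaves an inner node. At a vertex
  the flux is minus the Kirchhoff sum of the derivatives.
\<close>

context
  fixes A B :: "'e \<Rightarrow> real" and \<phi> :: "('v, 'e) point \<Rightarrow> real"
  assumes sample: "\<And>e i. e \<in> arcs G \<Longrightarrow> i \<le> n \<Longrightarrow>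
     \<phi> (node e i) = A e * cos (k * (real i * len e / real n)) + B e * sin (k * (real i * len e / real n))"
begin

lemma osc_flux_sample_inner:
  assumes e: "e \<in> arcs G" and i: "0 < i" "i < n"
  shows "osc_flux k \<phi> (node e i) = 0"
proof -
  define t where "t = k * (len e / real n)"
  have co: "k * (real (i + 1) * len e / real n) = k * (real i * len e / real n) + t"
    "k * (real (i - 1) * len e / real n) = k * (real i * len e / real n) - t"
    using i n_pos by (simp_all add: t_def field_simps of_nat_diff)
  have le: "i + 1 \<le> n" "i \<le> n" "i - 1 \<le> n" using i by auto
  have "2 * cos t * \<phi> (node e i) - \<phi> (node e (i + 1)) - \<phi> (node e (i - 1)) = 0"
    unfolding sample[OF e le(1)] sample[OF e le(2)] sample[OF e le(3)] co cos_add sin_add cos_diff sin_diff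
    by (simp add: algebra_simps)
  then show ?thesis unfolding osc_flux_inner[OF assms] t_def[symmetric] by simp
qed

lemma osc_flux_sample_vertex:
  "osc_flux k \<phi> (Vertex v) =
     - ((\<Sum>e | e \<in> arcs G \<and> tail G e = v. k * B e)
      + (\<Sum>e | e \<in> arcs G \<and> head G e = v. k * A e * sin (k * len e) - k * B e * cos (k * len e)))"
proof -
  have 1: "stiffness k (e, 0) * (\<phi> (node e 0) - \<phi> (node e 1)) - k\<^sup>2 * mass k (e, 0) * \<phi> (node e 0) = - (k * B e)"
    if e: "e \<in> arcs G" for e
    unfolding segment_slope'[OF e n_pos] using n_pos sin_step_pos[OF e] sample[OF e, of 0] sample[OF e, of 1]
    by (simp add: field_simps)
  have 2: "stiffness k (e, n - 1) * (\<phi> (node e n) - \<phi> (node e (n - 1))) - k\<^sup>2 * mass k (e, n - 1) * \<phi> (node e n)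
       = - (k * A e * sin (k * len e) - k * B e * cos (k * len e))"
    if e: "e \<in> arcs G" for e
  proof -
    define t where "t = k * (len e / real n)"
    have co: "k * (real (n - 1) * len e / real n) = k * len e - t" "k * (real n * len e / real n) = k * len e"
      using n_pos by (simp_all add: t_def field_simps of_nat_diff)
    have cs: "cos t * cos t = 1 - sin t * sin t" using sin_cos_squared_add3[of t] by linarith
    have "cos t * \<phi> (node e n) - \<phi> (node e (n - 1))
        = cos t * (A e * cos (k * len e) + B e * sin (k * len e)) -
          (A e * (cos (k * len e) * cos t + sin (k * len e) * sin t)
         + B e * (sin (k * len e) * cos t - cos (k * len e) * sin t))"
      unfolding sample[OF e order_refl] sample[OF e diff_le_self] co cos_diff sin_diff by simp
    also have "\<dots> = - (A e * sin (k * len e) - B e * cos (k * len e)) * sin t"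
      by (simp add: algebra_simps)
    finally have E: "cos t * \<phi> (node e n) - \<phi> (node e (n - 1)) = \<dots>" .
    have s: "sin t \<noteq> 0" using sin_step_pos[OF e] by (simp only: t_def less_irrefl less_imp_neq[symmetric] not_False_eq_True)
    have "n - 1 < n" using n_pos by simp
    from s show ?thesis
      unfolding segment_slope'[OF e \<open>n - 1 < n\<close>] t_def[symmetric] E by (simp add: field_simps)
  qed
  show ?thesis
    unfolding flux_vertex minus_add_distrib sum_negf[symmetric]
    by (intro arg_cong2[of _ _ _ _ "(+)"] sum.cong refl 1 2) auto
qed

end

text \<open>
  Conversely, the two-term recurrence at the inner nodes propagates \<open>A\<close> and \<open>B\<close>, which are read off
  from the first two nodes of an edge; this works because \<open>sin (k d) \<noteq> 0\<close>.
\<close>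

lemma sample_of_flux_eq_0:
  assumes flux: "\<And>w. w \<in> nodes \<Longrightarrow> osc_flux k \<phi> w = 0"
  obtains A B where "\<And>e i. e \<in> arcs G \<Longrightarrow> i \<le> n \<Longrightarrow>
     \<phi> (node e i) = A e * cos (k * (real i * len e / real n)) + B e * sin (k * (real i * len e / real n))"
proof -
  define A where "A e = \<phi> (node e 0)" for e
  define B where "B e = (\<phi> (node e 1) - A e * cos (k * (len e / real n))) / sin (k * (len e / real n))" for e
  have key: "\<phi> (node e i) = A e * cos (k * (real i * len e / real n)) + B e * sin (k * (real i * len e / real n))"
    if e: "e \<in> arcs G" and "i \<le> n" for e i
    using that(2)
  proof (induct i rule: less_induct)
    case (less i)
    consider "i = 0" | "i = 1" | j where "i = Suc (Suc j)" by (cases i; cases "i - 1") auto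
    then show ?case
    proof cases
      case 1 then show ?thesis by (simp add: A_def)
    next
      case 2 then show ?thesis using sin_step_pos[OF e] by (simp add: B_def)
    next
      case (3 j)
      define t where "t = k * (len e / real n)"
      define y where "y = k * (real (Suc j) * len e / real n)"
      have co: "k * (real i * len e / real n) = y + t" "k * (real j * len e / real n) = y - t"
        by (simp_all add: 3 t_def y_def field_simps add_divide_distrib)
      have j: "Suc j < n" using 3 less.prems by simp
      have "node e (Suc j) \<in> nodes" using e j by (force simp: nodes_def)
      from flux[OF this] have "2 * cos t * \<phi> (node e (Suc j)) - \<phi> (node e i) - \<phi> (node e j) = 0"
        using osc_flux_inner[OF e _ j, of \<phi>] sin_step_pos[OF e] k by (simp add: 3 t_def)
      moreover have "\<phi> (node e (Suc j)) = A e * cos y + B e * sin y"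
        using less.hyps[of "Suc j"] 3 less.prems by (simp add: y_def)
      moreover have "\<phi> (node e j) = A e * cos (y - t) + B e * sin (y - t)"
        using less.hyps[of j] 3 less.prems by (simp only: co)
      ultimately show ?thesis unfolding co
        by (simp add: cos_add sin_add cos_diff sin_diff algebra_simps)
    qed
  qed
  show thesis by (rule that[of A B]) (rule key)
qed

lemma eigenvalue_of_flux_eq_0:
  assumes flux: "\<And>w. w \<in> nodes \<Longrightarrow> osc_flux k \<phi> w = 0" and nz: "\<exists>w\<in>nodes. \<phi> w \<noteq> 0"
  shows "k\<^sup>2 \<in> eigenvalues G len"
proof -
  obtain A B where sample: "\<And>e i. e \<in> arcs G \<Longrightarrow> i \<le> n \<Longrightarrow>
     \<phi> (node e i) = A e * cos (k * (real i * len e / real n)) + B e * sin (k * (real i * len e / real n))"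
    using sample_of_flux_eq_0[OF flux] by blast
  define g where "g e x = A e * cos (k * x) + B e * sin (k * x)" for e x
  define g' where "g' e x = - k * A e * sin (k * x) + k * B e * cos (k * x)" for e x
  define f where "f e x = (if e \<in> arcs G \<and> x \<in> {0..len e} then complex_of_real (g e x) else 0)" for e x
  have dg: "((\<lambda>x. complex_of_real (g e x)) has_vector_derivative of_real (g' e x)) (at x)"
    "((\<lambda>x. complex_of_real (g' e x)) has_vector_derivative of_real (- k\<^sup>2 * g e x)) (at x)" for e x
    unfolding g_def g'_def
    by (auto intro!: has_vector_derivative_of_real derivative_eq_intros simp: power2_eq_square algebra_simps)
  have end0: "g e 0 = \<phi> (Vertex (tail G e))" and endl: "g e (len e) = \<phi> (Vertex (head G e))" if "e \<in> arcs G" for e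
    using sample[OF that, of 0] sample[OF that, of n] n_pos by (simp_all add: node_0 node_n[OF that] g_def)
  have "laplacian G len f (graph_fun_scale (of_real (k\<^sup>2)) f)"
    unfolding laplacian_def
  proof (intro conjI;
      (rule exI[of _ "\<lambda>e x. of_real (g' e x)"], rule exI[of _ "\<lambda>e x. of_real (- k\<^sup>2 * g e x)"], intro conjI ballI)?)
    show "supported_on_edges G len f" by (auto simp: supported_on_edges_def f_def)
    show "continuous_at_vertices G len f"
      unfolding continuous_at_vertices_def using len_pos
      by (intro exI[of _ "\<lambda>v. of_real (\<phi> (Vertex v))"]) (auto simp: f_def less_imp_le end0 endl)
    show "kirchhoff G len (\<lambda>e x. of_real (g' e x))"
      unfolding kirchhoff_def
    proof
      fix v assume "v \<in> verts G"
      then have "osc_flux k \<phi> (Vertex v) = 0" by (intro flux vertex_in_nodes)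
      moreover have "osc_flux k \<phi> (Vertex v) = - ((\<Sum>e | e \<in> arcs G \<and> tail G e = v. k * B e)
          + (\<Sum>e | e \<in> arcs G \<and> head G e = v. k * A e * sin (k * len e) - k * B e * cos (k * len e)))"
        by (rule osc_flux_sample_vertex) (rule sample)
      ultimately have "(\<Sum>e | e \<in> arcs G \<and> tail G e = v. g' e 0) + (\<Sum>e | e \<in> arcs G \<and> head G e = v. - g' e (len e)) = 0"
        by (simp add: g'_def)
      then have "complex_of_real ((\<Sum>e | e \<in> arcs G \<and> tail G e = v. g' e 0) + (\<Sum>e | e \<in> arcs G \<and> head G e = v. - g' e (len e))) = 0"
        by (simp only: of_real_0)
      then show "(\<Sum>e | e \<in> arcs G \<and> tail G e = v. complex_of_real (g' e 0))
          + (\<Sum>e | e \<in> arcs G \<and> head G e = v. - complex_of_real (g' e (len e))) = 0"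
        by simp
    qed
    show "H2_edge (len e) (f e) (\<lambda>x. of_real (g' e x)) (\<lambda>x. of_real (- k\<^sup>2 * g e x))" if "e \<in> arcs G" for e
      by (rule H2_edge_of_smooth[OF _ dg]) (use that len_pos[OF that] in \<open>auto simp: f_def g_def intro!: continuous_intros\<close>)
    show "AE x in lborel. x \<in> {0<..<len e} \<longrightarrow> graph_fun_scale (complex_of_real (k\<^sup>2)) f e x = - complex_of_real (- k\<^sup>2 * g e x)"
      if "e \<in> arcs G" for e
      using that by (intro always_eventually) (auto simp: graph_fun_scale_def f_def)
  qed
  moreover have "f \<noteq> 0"
  proof -
    obtain e i where w: "e \<in> arcs G" "i \<le> n" "\<phi> (node e i) \<noteq> 0" using nz by (auto simp: nodes_def)
    have "g e (real i * len e / real n) \<noteq> 0"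
      using sample[OF w(1,2)] w(3) by (simp add: g_def)
    then have "f e (real i * len e / real n) \<noteq> 0"
      using w(1) coordinate_in[OF w(1,2)] by (simp add: f_def)
    then show ?thesis by (auto simp: fun_eq_iff)
  qed
  ultimately show ?thesis by (auto simp: eigenvalues_def eigenspace_def)
qed

text \<open>
  A complex eigenfunction is sampled after taking its real or imaginary part, here \<open>\<rho>\<close>. If all
  samples vanished, then \<open>f = B sin (k x)\<close> with \<open>B sin (k d) = 0\<close> on each edge, so \<open>f\<close> would vanish.
\<close>

lemma flux_eq_0_of_eigenvalue:
  assumes "k\<^sup>2 \<in> eigenvalues G len"
  obtains \<phi> where "\<And>w. w \<in> nodes \<Longrightarrow> osc_flux k \<phi> w = 0" "\<exists>w\<in>nodes. \<phi> w \<noteq> 0"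
proof -
  obtain f where f: "f \<in> eigenspace G len (k\<^sup>2)" "f \<noteq> 0" using assms by (auto simp: eigenvalues_def)
  obtain f' where c: "continuous_at_vertices G len f" and kir: "kirchhoff G len f'"
    and df: "\<And>e x. e \<in> arcs G \<Longrightarrow> x \<in> {0..len e} \<Longrightarrow> (f e has_vector_derivative f' e x) (at x within {0..len e})"
    "\<And>e x. e \<in> arcs G \<Longrightarrow> x \<in> {0..len e} \<Longrightarrow>
       (f' e has_vector_derivative - of_real (k\<^sup>2) * f e x) (at x within {0..len e})"
    using f(1) by (rule eigenspaceE) blast
  obtain cv where cv: "\<And>e. e \<in> arcs G \<Longrightarrow> f e 0 = cv (tail G e) \<and> f e (len e) = cv (head G e)"
    using c unfolding continuous_at_vertices_def by blast
  have sol: "f e x = f e 0 * of_real (cos (k * x)) + (f' e 0 / of_real k) * of_real (sin (k * x))"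
    "f' e x = - f e 0 * of_real (k * sin (k * x)) + f' e 0 * of_real (cos (k * x))"
    if e: "e \<in> arcs G" and x: "x \<in> {0..len e}" for e x
  proof -
    show "f e x = f e 0 * of_real (cos (k * x)) + (f' e 0 / of_real k) * of_real (sin (k * x))"
      by (intro harmonic_oscillator(1)[OF k len_pos[OF e] _ _ x] df e)
    show "f' e x = - f e 0 * of_real (k * sin (k * x)) + f' e 0 * of_real (cos (k * x))"
      by (intro harmonic_oscillator(2)[OF k len_pos[OF e] _ _ x] df e)
  qed
  define F where "F p = (case p of Vertex v \<Rightarrow> cv v | Inner e x \<Rightarrow> f e x)" for p
  have F: "F (node e i) = f e (real i * len e / real n)" if "e \<in> arcs G" "i \<le> n" for e i
    unfolding node_def edge_point_def F_def using cv[OF that(1)] by auto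
  have zero: "osc_flux k (\<lambda>p. \<rho> (F p)) w = 0"
    if \<rho>: "linear \<rho>" "\<And>z r. \<rho> (z * of_real r) = \<rho> z * r" and w: "w \<in> nodes" for \<rho> :: "complex \<Rightarrow> real" and w
  proof -
    define A where "A e = \<rho> (f e 0)" for e
    define B where "B e = \<rho> (f' e 0) / k" for e
    have \<rho>k: "\<rho> (z / of_real k) = \<rho> z / k" for z
      using \<rho>(2)[of z "1 / k"] by simp
    have sample: "\<rho> (F (node e i)) = A e * cos (k * (real i * len e / real n)) + B e * sin (k * (real i * len e / real n))"
      if "e \<in> arcs G" "i \<le> n" for e i
      unfolding F[OF that] sol(1)[OF that(1) coordinate_in[OF that]]
      by (simp only: linear_add[OF \<rho>(1)] \<rho>(2) \<rho>k A_def B_def)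
    have slope: "\<rho> (f' e (len e)) = - (k * A e * sin (k * len e) - k * B e * cos (k * len e))" if "e \<in> arcs G" for e
    proof -
      have "len e \<in> {0..len e}" using len_pos[OF that] by simp
      note sol(2)[OF that this]
      then have "\<rho> (f' e (len e)) = \<rho> ((- f e 0) * of_real (k * sin (k * len e)) + f' e 0 * of_real (cos (k * len e)))" by simp
      also have "\<dots> = - \<rho> (f e 0) * (k * sin (k * len e)) + \<rho> (f' e 0) * cos (k * len e)"
        unfolding linear_add[OF \<rho>(1)] \<rho>(2) linear_neg[OF \<rho>(1)] by simp
      finally show ?thesis using k by (simp add: A_def B_def)
    qed
    obtain e i where ei: "w = node e i" "e \<in> arcs G" "i \<le> n" using w by (auto simp: nodes_def)
    have vert: "osc_flux k (\<lambda>p. \<rho> (F p)) (Vertex v) = 0" if "v \<in> verts G" for v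
    proof -
      have "0 = \<rho> ((\<Sum>e | e \<in> arcs G \<and> tail G e = v. f' e 0) + (\<Sum>e | e \<in> arcs G \<and> head G e = v. - f' e (len e)))"
        using kir that by (simp add: kirchhoff_def linear_0[OF \<rho>(1)])
      also have "\<dots> = (\<Sum>e | e \<in> arcs G \<and> tail G e = v. k * B e)
        + (\<Sum>e | e \<in> arcs G \<and> head G e = v. k * A e * sin (k * len e) - k * B e * cos (k * len e))"
        unfolding linear_add[OF \<rho>(1)] linear_sum[OF \<rho>(1)] linear_neg[OF \<rho>(1)]
        using k by (intro arg_cong2[of _ _ _ _ "(+)"] sum.cong) (auto simp: slope B_def)
      finally have "(\<Sum>e | e \<in> arcs G \<and> tail G e = v. k * B e)
        + (\<Sum>e | e \<in> arcs G \<and> head G e = v. k * A e * sin (k * len e) - k * B e * cos (k * len e)) = 0" by simp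
      moreover have "osc_flux k (\<lambda>p. \<rho> (F p)) (Vertex v) = - ((\<Sum>e | e \<in> arcs G \<and> tail G e = v. k * B e)
          + (\<Sum>e | e \<in> arcs G \<and> head G e = v. k * A e * sin (k * len e) - k * B e * cos (k * len e)))"
        by (rule osc_flux_sample_vertex) (rule sample)
      ultimately show ?thesis by simp
    qed
    consider "i = 0" | "i = n" | "0 < i" "i < n" using ei(3) by linarith
    then show ?thesis
    proof cases
      case 1 then show ?thesis using vert ei by (simp add: node_0)
    next
      case 2 then show ?thesis using vert ei by (simp add: node_n)
    next
      case 3
      show ?thesis unfolding ei(1) by (rule osc_flux_sample_inner[of _ A B, OF _ ei(2) 3]) (rule sample)
    qed
  qed
  have "\<exists>w\<in>nodes. F w \<noteq> 0"
  proof (rule ccontr)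
    assume "\<not> (\<exists>w\<in>nodes. F w \<noteq> 0)"
    then have F0: "f e (real i * len e / real n) = 0" if "e \<in> arcs G" "i \<le> n" for e i
      using that F[OF that] by (force simp: nodes_def)
    have "f e x = 0" for e x
    proof (cases "e \<in> arcs G \<and> x \<in> {0..len e}")
      case True
      then have e: "e \<in> arcs G" and x: "x \<in> {0..len e}" by auto
      note sole = sol(1)[OF e]
      have 0: "f e 0 = 0" using F0[OF e, of 0] by simp
      have "f e (1 * len e / real n) = 0" using F0[OF e, of 1] n_pos by simp
      with sole[OF coordinate_in[OF e, of 1]] 0 have "f' e 0 / of_real k * of_real (sin (k * (len e / real n))) = 0"
        using n_pos by simp
      then have "f' e 0 / of_real k = 0" using sin_step_pos[OF e] by auto
      then show ?thesis using sole[OF x] unfolding 0 by (simp only: mult_zero_left add_0_right)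
    next
      case False then show ?thesis using eigenspace_supported[OF f(1)] by blast
    qed
    then show False using f(2) by (auto simp: fun_eq_iff)
  qed
  then obtain w where w: "w \<in> nodes" "F w \<noteq> 0" by blast
  then consider "Re (F w) \<noteq> 0" | "Im (F w) \<noteq> 0" by (auto simp: complex_eq_iff)
  then show thesis
  proof cases
    case 1
    show thesis
      by (rule that[of "\<lambda>p. Re (F p)"]) (use zero[of Re] w 1 in \<open>auto simp: bounded_linear_Re bounded_linear.linear\<close>)
  next
    case 2
    show thesis
      by (rule that[of "\<lambda>p. Im (F p)"]) (use zero[of Im] w 2 in \<open>auto simp: bounded_linear_Im bounded_linear.linear\<close>)
  qed
qed

end

end

section \<open>Tent functions on balls\<close>

context subdivided_graph
begin

lemma seg_ends_dist:
  assumes "s \<in> segments"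
  shows "dist\<^sub>G (seg_start s) (seg_end s) \<le> seg_len s"
proof -
  obtain e i where s: "s = (e, i)" "e \<in> arcs G" "i < n" using assms by (auto simp: segments_def)
  have "dist\<^sub>G (seg_start s) (seg_end s) \<le> \<bar>real (Suc i) * len e / real n - real i * len e / real n\<bar>"
    unfolding s(1) seg_start_def seg_end_def node_def fst_conv snd_conv
    by (rule graph_dist_pt_le) (use s coordinate_in[of e i] coordinate_in[of e "Suc i"] in auto)
  also have "\<dots> = len e / real n"
    using len_pos[OF s(2)] n_pos by (simp add: field_simps)
  finally show ?thesis by (simp add: s(1) seg_len_def)
qed

lemma ends_in_points: "s \<in> segments \<Longrightarrow> seg_start s \<in> points G len" "s \<in> segments \<Longrightarrow> seg_end s \<in> points G len"
  using ends_in nodes_subset_points by blast+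

text \<open>
  The tent function \<open>(r - dist)\<^sub>+\<close> enters through its node values, so its ball is measured by the
  segments at whose ends these values do not both vanish.
\<close>

definition tent :: "real \<Rightarrow> ('v, 'e) point \<Rightarrow> ('v, 'e) point \<Rightarrow> real" where
  "tent r p w = max 0 (r - dist\<^sub>G w p)"

definition ball_segments :: "real \<Rightarrow> ('v, 'e) point \<Rightarrow> ('e \<times> nat) set" where
  "ball_segments r p = {s \<in> segments. tent r p (seg_start s) \<noteq> 0 \<or> tent r p (seg_end s) \<noteq> 0}"

definition ball_length :: "real \<Rightarrow> ('v, 'e) point \<Rightarrow> real" where
  "ball_length r p = (\<Sum>s\<in>ball_segments r p. seg_len s)"

lemma tent_nonneg: "0 \<le> tent r p w" by (simp add: tent_def)

lemma tent_nonzeroD: "tent r p w \<noteq> 0 \<Longrightarrow> dist\<^sub>G w p < r"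
  by (simp add: tent_def max_def split: if_splits)

lemma tent_lipschitz:
  assumes s: "s \<in> segments" and p: "p \<in> points G len"
  shows "\<bar>tent r p (seg_start s) - tent r p (seg_end s)\<bar> \<le> seg_len s"
proof -
  note pts = ends_in_points[OF s]
  have "dist\<^sub>G (seg_start s) p \<le> dist\<^sub>G (seg_start s) (seg_end s) + dist\<^sub>G (seg_end s) p"
    "dist\<^sub>G (seg_end s) p \<le> dist\<^sub>G (seg_end s) (seg_start s) + dist\<^sub>G (seg_start s) p"
    using pts p by (auto intro: graph_dist_triangle)
  moreover have "dist\<^sub>G (seg_end s) (seg_start s) = dist\<^sub>G (seg_start s) (seg_end s)" by (rule graph_dist_commute)
  ultimately show ?thesis using seg_ends_dist[OF s] unfolding tent_def by linarith
qed

context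
  fixes \<delta> :: real
  assumes mesh: "\<And>e. e \<in> arcs G \<Longrightarrow> len e / real n \<le> \<delta>"
begin

lemma mesh_pos: "0 < \<delta>"
proof -
  obtain e where e: "e \<in> arcs G" using arcs_nonempty by auto
  have "0 < len e / real n" using len_pos[OF e] n_pos by simp
  with mesh[OF e] show ?thesis by linarith
qed

lemma seg_len_le: "s \<in> segments \<Longrightarrow> seg_len s \<le> \<delta>"
  using mesh by (auto simp: segments_def seg_len_def)

lemma node_near:
  assumes p: "p \<in> points G len"
  obtains w where "w \<in> nodes" "dist\<^sub>G w p \<le> \<delta>"
  using p
proof (cases rule: points_cases)
  case (1 v)
  then show thesis using that[of p] vertex_in_nodes graph_dist_self[OF p] mesh_pos by simp
next
  case (2 e x)
  define y where "y = x * real n / len e"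
  define i where "i = nat \<lfloor>y\<rfloor>"
  have l: "0 < len e" by (rule len_pos[OF 2(1)])
  have y: "0 \<le> y" "y < real n" using 2 l n_pos by (auto simp: y_def field_simps)
  have i: "real i \<le> y" "y < real i + 1" using y by (auto simp: i_def of_nat_nat)
  then have "i \<le> n" using y by linarith
  have "node e i \<in> nodes" using 2(1) \<open>i \<le> n\<close> by (force simp: nodes_def)
  moreover have "dist\<^sub>G (node e i) p \<le> \<bar>x - real i * len e / real n\<bar>"
    unfolding 2(4) node_def by (rule graph_dist_pt_le) (use 2 coordinate_in[OF 2(1) \<open>i \<le> n\<close>] in auto)
  moreover have "x - real i * len e / real n = (y - real i) * (len e / real n)"
    using l n_pos by (simp add: y_def field_simps)
  moreover have "\<bar>(y - real i) * (len e / real n)\<bar> \<le> 1 * (len e / real n)"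
    unfolding abs_mult using i l n_pos by (intro mult_mono) auto
  ultimately show thesis using that[of "node e i"] mesh[OF 2(1)] by simp
qed

text \<open>
  Some node within \<open>\<delta>\<close> of \<open>p\<close> has tent value at least \<open>r - \<delta>\<close>, and some node within \<open>\<delta>\<close> of \<open>q\<close> has
  tent value zero. Applied to the power \<open>1\<close> this bounds the ball length from below; applied to the
  cube it bounds the square integral, since \<open>f\<^sup>2 \<ge> f\<^sup>2 |f'| = |(f\<^sup>3)'| / 3\<close> when \<open>|f'| \<le> 1\<close>.
\<close>

lemma tent_power_variation:
  assumes p: "p \<in> points G len" and q: "q \<in> points G len" and far: "r + \<delta> \<le> dist\<^sub>G q p"
    and r: "\<delta> \<le> r" and j: "0 < j"
  shows "(r - \<delta>) ^ j \<le> (\<Sum>s\<in>segments. \<bar>tent r p (seg_start s) ^ j - tent r p (seg_end s) ^ j\<bar>)"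
proof -
  obtain u where u: "u \<in> nodes" "dist\<^sub>G u p \<le> \<delta>" by (rule node_near[OF p])
  obtain v where v: "v \<in> nodes" "dist\<^sub>G v q \<le> \<delta>" by (rule node_near[OF q])
  have "dist\<^sub>G q p \<le> dist\<^sub>G q v + dist\<^sub>G v p"
    using p q v nodes_subset_points by (intro graph_dist_triangle) auto
  then have "tent r p v = 0" using v(2) far by (simp add: tent_def graph_dist_commute[of q v])
  moreover have "r - \<delta> \<le> tent r p u" using u(2) by (simp add: tent_def)
  then have "(r - \<delta>) ^ j \<le> tent r p u ^ j" using r by (intro power_mono) auto
  ultimately show ?thesis
    using total_variation[OF u(1) v(1), of "\<lambda>w. tent r p w ^ j"] j by (simp add: power_0_left)
qed

lemma ball_length_ge:
  assumes p: "p \<in> points G len" and q: "q \<in> points G len" and far: "r + \<delta> \<le> dist\<^sub>G q p"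
    and r: "\<delta> \<le> r"
  shows "r - \<delta> \<le> ball_length r p"
proof -
  have "r - \<delta> \<le> (\<Sum>s\<in>segments. \<bar>tent r p (seg_start s) - tent r p (seg_end s)\<bar>)"
    using tent_power_variation[OF assms, of 1] by simp
  also have "\<dots> = (\<Sum>s\<in>ball_segments r p. \<bar>tent r p (seg_start s) - tent r p (seg_end s)\<bar>)"
    using finite_S by (intro sum.mono_neutral_right) (auto simp: ball_segments_def)
  also have "\<dots> \<le> ball_length r p"
    unfolding ball_length_def by (rule sum_mono) (auto simp: ball_segments_def intro: tent_lipschitz p)
  finally show ?thesis .
qed

lemma balls_disjoint:
  assumes p: "p \<in> points G len" and q: "q \<in> points G len" and far: "2 * r + \<delta> \<le> dist\<^sub>G p q"
  shows "ball_segments r p \<inter> ball_segments r q = {}"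
proof (rule ccontr)
  assume "ball_segments r p \<inter> ball_segments r q \<noteq> {}"
  then obtain s where s: "s \<in> segments"
    and tp: "tent r p (seg_start s) \<noteq> 0 \<or> tent r p (seg_end s) \<noteq> 0"
    and tq: "tent r q (seg_start s) \<noteq> 0 \<or> tent r q (seg_end s) \<noteq> 0"
    by (auto simp: ball_segments_def)
  note pts = ends_in_points[OF s]
  obtain u where u: "u \<in> {seg_start s, seg_end s}" "dist\<^sub>G u p < r"
    using tp tent_nonzeroD by blast
  obtain v where v: "v \<in> {seg_start s, seg_end s}" "dist\<^sub>G v q < r"
    using tq tent_nonzeroD by blast
  have uv: "u \<in> points G len" "v \<in> points G len" using u v pts by auto
  have "dist\<^sub>G u v \<le> \<delta>"
    using u v seg_ends_dist[OF s] seg_len_le[OF s] graph_dist_self pts mesh_pos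
      graph_dist_commute[of "seg_end s" "seg_start s"] by auto
  moreover have "dist\<^sub>G p q \<le> dist\<^sub>G p u + dist\<^sub>G u q" "dist\<^sub>G u q \<le> dist\<^sub>G u v + dist\<^sub>G v q"
    using p q uv by (auto intro: graph_dist_triangle)
  ultimately show False using u(2) v(2) far by (simp add: graph_dist_commute[of p u])
qed

context
  fixes K :: real
  assumes K: "0 < K" and K\<delta>: "K * \<delta> \<le> 1"
begin

lemma K_seg_le:
  assumes "s \<in> segments" "k \<in> {0..K}"
  shows "k * seg_len s \<le> K * \<delta>" "k * seg_len s \<le> 1" "k * (seg_len s / 2) \<le> 1"
proof -
  show 1: "k * seg_len s \<le> K * \<delta>"
    using assms seg_len_le[OF assms(1)] seg_len_pos[OF assms(1)] K by (intro mult_mono) auto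
  then show 2: "k * seg_len s \<le> 1" using K\<delta> by linarith
  have "0 \<le> k * seg_len s" using assms seg_len_pos[OF assms(1)] by simp
  then show "k * (seg_len s / 2) \<le> 1" using 2 by simp
qed

lemma stiffness_pos: "k \<in> {0..K} \<Longrightarrow> s \<in> segments \<Longrightarrow> 0 < stiffness k s"
  using K_seg_le(2) seg_len_pos by (simp add: stiffness_def sin_ratio_pos)

lemma mass_pos: "k \<in> {0..K} \<Longrightarrow> s \<in> segments \<Longrightarrow> 0 < mass k s"
  using K_seg_le(3)[of s k] seg_len_pos[of s]
  by (auto simp: mass_def intro!: divide_pos_pos sin_ratio_pos cos_pos_of_le_1)

lemma continuous_stiffness: "s \<in> segments \<Longrightarrow> continuous_on {0..K} (\<lambda>k. stiffness k s)"
  unfolding stiffness_def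
proof (intro continuous_on_divide continuous_on_const continuous_sin_ratio ballI)
  fix k assume "s \<in> segments" "k \<in> {0..K}"
  then show "sin_ratio (seg_len s) k \<noteq> 0" using stiffness_pos[of k s] by (auto simp: stiffness_def)
qed

lemma continuous_mass: "s \<in> segments \<Longrightarrow> continuous_on {0..K} (\<lambda>k. mass k s)"
  unfolding mass_def
proof (intro continuous_on_divide continuous_sin_ratio ballI)
  show "continuous_on {0..K} (\<lambda>k. cos (k * (seg_len s / 2)))" by (intro continuous_intros)
  fix k assume "s \<in> segments" "k \<in> {0..K}"
  then show "cos (k * (seg_len s / 2)) \<noteq> 0" using mass_pos[of k s] by (auto simp: mass_def)
qed

text \<open>
  Up to the factor \<open>1 / cos (K \<delta>)\<close>, which tends to \<open>1\<close> with the mesh, the energy of a segment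
  of slope at most \<open>1\<close> is bounded by its length.
\<close>

lemma stiffness_le:
  assumes s: "s \<in> segments"
  shows "stiffness K s * (seg_len s)\<^sup>2 \<le> seg_len s / cos (K * \<delta>)"
proof -
  let ?l = "seg_len s"
  have l: "0 < ?l" by (rule seg_len_pos[OF s])
  have Kl: "0 < K * ?l" using K l by simp
  have le: "K * ?l \<le> K * \<delta>" "K * ?l \<le> 1" using K_seg_le[OF s, of K] K by auto
  have c: "0 < cos (K * \<delta>)" using Kl le K\<delta> by (intro cos_pos_of_le_1) auto
  have "cos (K * \<delta>) \<le> cos (K * ?l)"
    using Kl le K\<delta> pi_gt3 by (intro cos_monotone_0_pi_le) auto
  then have "K * ?l * cos (K * \<delta>) \<le> K * ?l * cos (K * ?l)" using Kl by (intro mult_left_mono) auto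
  also have "\<dots> \<le> sin (K * ?l)" using Kl le pi_gt3 by (intro mult_cos_le_sin) auto
  finally have *: "K * ?l * cos (K * \<delta>) \<le> sin (K * ?l)" .
  have sn: "0 < sin (K * ?l)" using Kl le pi_gt3 by (intro sin_gt_zero) auto
  have "stiffness K s * ?l\<^sup>2 = K * ?l\<^sup>2 / sin (K * ?l)"
    using K by (simp add: stiffness_def sin_ratio_def)
  also have "\<dots> \<le> ?l / cos (K * \<delta>)"
    using mult_left_mono[OF *, of ?l] l sn c by (simp add: field_simps power2_eq_square)
  finally show ?thesis .
qed

lemma mass_ge:
  assumes s: "s \<in> segments"
  shows "seg_len s / 2 \<le> mass K s"
proof -
  define t where "t = K * (seg_len s / 2)"
  have t: "0 < t" "t \<le> 1" using K seg_len_pos[OF s] K_seg_le(3)[OF s, of K] by (auto simp: t_def)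
  have c: "0 < cos t" using t by (intro cos_pos_of_le_1) auto
  have "t * cos t \<le> sin t" using t pi_gt3 by (intro mult_cos_le_sin) auto
  then have "t \<le> sin t / cos t" using c by (simp add: field_simps)
  then have "t / K \<le> (sin t / cos t) / K" using K by (intro divide_right_mono) auto
  moreover have "mass K s = (sin t / cos t) / K" using K by (simp add: mass_def sin_ratio_def t_def)
  moreover have "seg_len s / 2 = t / K" using K by (simp add: t_def)
  ultimately show ?thesis by (simp only:)
qed

text \<open>
  The discrete form of \<open>|(f\<^sup>3)'| / 3 \<le> f\<^sup>2\<close> on one segment. The lumped mass is at least the
  integral \<open>l (x\<^sup>2 + x y + y\<^sup>2) / 3\<close> of the squared affine interpolant.
\<close>

lemma cubic_le_mass:
  fixes r :: real
  assumes s: "s \<in> segments" and p: "p \<in> points G len"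
  defines "x \<equiv> tent r p (seg_start s)" and "y \<equiv> tent r p (seg_end s)"
  shows "\<bar>x ^ 3 - y ^ 3\<bar> / 3 \<le> mass K s * (x\<^sup>2 + y\<^sup>2)"
proof -
  have xy: "0 \<le> x" "0 \<le> y" unfolding x_def y_def by (rule tent_nonneg)+
  have "x ^ 3 - y ^ 3 = (x - y) * (x\<^sup>2 + x * y + y\<^sup>2)" by algebra
  then have "\<bar>x ^ 3 - y ^ 3\<bar> = \<bar>x - y\<bar> * (x\<^sup>2 + x * y + y\<^sup>2)" using xy by (simp add: abs_mult)
  also have "\<dots> \<le> seg_len s * (x\<^sup>2 + x * y + y\<^sup>2)"
    using tent_lipschitz[OF s p] xy by (intro mult_right_mono) (auto simp: x_def y_def)
  also have "\<dots> \<le> seg_len s * (3 / 2 * (x\<^sup>2 + y\<^sup>2))"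
    using seg_len_pos[OF s] zero_le_power2[of "x - y"] by (intro mult_left_mono) (auto simp: power2_diff)
  also have "\<dots> = 3 * (seg_len s / 2 * (x\<^sup>2 + y\<^sup>2))" by simp
  also have "\<dots> \<le> 3 * (mass K s * (x\<^sup>2 + y\<^sup>2))"
    using mass_ge[OF s] by (intro mult_left_mono mult_right_mono) auto
  finally show ?thesis by simp
qed

lemma form_tent_le:
  assumes p: "p \<in> points G len" and q: "q \<in> points G len" and far: "r + \<delta> \<le> dist\<^sub>G q p"
    and r: "\<delta> \<le> r"
  shows "form (stiffness K) (\<lambda>s. K\<^sup>2 * mass K s) (tent r p) (tent r p)
       \<le> ball_length r p / cos (K * \<delta>) - K\<^sup>2 * (r - \<delta>) ^ 3 / 3"
proof -
  let ?x = "\<lambda>s. tent r p (seg_start s)" and ?y = "\<lambda>s. tent r p (seg_end s)"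
  have "form (stiffness K) (\<lambda>s. K\<^sup>2 * mass K s) (tent r p) (tent r p)
      = (\<Sum>s\<in>segments. stiffness K s * (?x s - ?y s)\<^sup>2) - (\<Sum>s\<in>segments. K\<^sup>2 * (mass K s * ((?x s)\<^sup>2 + (?y s)\<^sup>2)))"
    unfolding form_def sum_subtractf[symmetric] by (rule sum.cong) (auto simp: power2_eq_square)
  moreover have "(\<Sum>s\<in>segments. stiffness K s * (?x s - ?y s)\<^sup>2) \<le> ball_length r p / cos (K * \<delta>)"
  proof -
    have "(\<Sum>s\<in>segments. stiffness K s * (?x s - ?y s)\<^sup>2) = (\<Sum>s\<in>ball_segments r p. stiffness K s * (?x s - ?y s)\<^sup>2)"
      using finite_S by (intro sum.mono_neutral_right) (auto simp: ball_segments_def)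
    also have "\<dots> \<le> (\<Sum>s\<in>ball_segments r p. seg_len s / cos (K * \<delta>))"
    proof (rule sum_mono)
      fix s assume "s \<in> ball_segments r p"
      then have s: "s \<in> segments" by (simp add: ball_segments_def)
      have "(?x s - ?y s)\<^sup>2 \<le> (seg_len s)\<^sup>2"
        using tent_lipschitz[OF s p] seg_len_pos[OF s] by (simp add: abs_le_square_iff[symmetric])
      then have "stiffness K s * (?x s - ?y s)\<^sup>2 \<le> stiffness K s * (seg_len s)\<^sup>2"
        using stiffness_pos[OF _ s, of K] K by (intro mult_left_mono) auto
      then show "stiffness K s * (?x s - ?y s)\<^sup>2 \<le> seg_len s / cos (K * \<delta>)"
        using stiffness_le[OF s] by linarith
    qed
    also have "\<dots> = ball_length r p / cos (K * \<delta>)"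
      by (simp add: ball_length_def sum_divide_distrib)
    finally show ?thesis .
  qed
  moreover have "K\<^sup>2 * (r - \<delta>) ^ 3 / 3 \<le> (\<Sum>s\<in>segments. K\<^sup>2 * (mass K s * ((?x s)\<^sup>2 + (?y s)\<^sup>2)))"
  proof -
    have "(r - \<delta>) ^ 3 / 3 \<le> (\<Sum>s\<in>segments. \<bar>?x s ^ 3 - ?y s ^ 3\<bar>) / 3"
      using tent_power_variation[OF assms, of 3] by simp
    also have "\<dots> = (\<Sum>s\<in>segments. \<bar>?x s ^ 3 - ?y s ^ 3\<bar> / 3)" by (rule sum_divide_distrib)
    also have "\<dots> \<le> (\<Sum>s\<in>segments. mass K s * ((?x s)\<^sup>2 + (?y s)\<^sup>2))"
      by (intro sum_mono cubic_le_mass p)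
    finally have "K\<^sup>2 * ((r - \<delta>) ^ 3 / 3) \<le> K\<^sup>2 * (\<Sum>s\<in>segments. mass K s * ((?x s)\<^sup>2 + (?y s)\<^sup>2))"
      by (rule mult_left_mono) simp
    then show ?thesis by (simp add: sum_distrib_left)
  qed
  ultimately show ?thesis by linarith
qed

text \<open>
  Both tents have negative energy at frequency \<open>K\<close>. Since no segment meets both balls, so has every
  nontrivial combination of the tents; the one with mean zero is the test function.
\<close>

lemma least_positive_eigenvalue_below:
  assumes p: "p \<in> points G len" and q: "q \<in> points G len" and far: "2 * r + \<delta> \<le> dist\<^sub>G p q"
    and r: "\<delta> \<le> r"
    and small: "ball_length r p < cos (K * \<delta>) * K\<^sup>2 * (r - \<delta>) ^ 3 / 3"
      "ball_length r q < cos (K * \<delta>) * K\<^sup>2 * (r - \<delta>) ^ 3 / 3"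
  obtains \<mu> where "\<mu> \<in> eigenvalues G len" "0 < \<mu>" "\<mu> < K\<^sup>2"
    "\<And>\<nu>. \<nu> \<in> eigenvalues G len \<Longrightarrow> 0 < \<nu> \<Longrightarrow> \<mu> \<le> \<nu>"
proof -
  let ?c = "\<lambda>s. K\<^sup>2 * mass K s"
  let ?Q = "form (stiffness K) ?c"
  have r0: "0 < r" using r mesh_pos by linarith
  have c0: "0 < cos (K * \<delta>)" using K mesh_pos K\<delta> by (intro cos_pos_of_le_1) auto
  have neg: "?Q (tent r p) (tent r p) < 0" "?Q (tent r q) (tent r q) < 0"
  proof -
    have "?Q (tent r p) (tent r p) \<le> ball_length r p / cos (K * \<delta>) - K\<^sup>2 * (r - \<delta>) ^ 3 / 3"
      by (rule form_tent_le[OF p q _ r]) (use far r0 in \<open>simp add: graph_dist_commute[of q p]\<close>)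
    moreover have "ball_length r p / cos (K * \<delta>) < K\<^sup>2 * (r - \<delta>) ^ 3 / 3"
      using small(1) c0 by (simp add: field_simps)
    ultimately show "?Q (tent r p) (tent r p) < 0" by linarith
    have "?Q (tent r q) (tent r q) \<le> ball_length r q / cos (K * \<delta>) - K\<^sup>2 * (r - \<delta>) ^ 3 / 3"
      by (rule form_tent_le[OF q p _ r]) (use far r0 in simp)
    moreover have "ball_length r q / cos (K * \<delta>) < K\<^sup>2 * (r - \<delta>) ^ 3 / 3"
      using small(2) c0 by (simp add: field_simps)
    ultimately show "?Q (tent r q) (tent r q) < 0" by linarith
  qed
  have disj: "?Q (tent r p) (tent r q) = 0"
    unfolding form_def
  proof (rule sum.neutral, rule ballI)
    fix s assume "s \<in> segments"
    then have "s \<notin> ball_segments r p \<or> s \<notin> ball_segments r q"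
      using balls_disjoint[OF p q far] by blast
    then show "stiffness K s * (tent r p (seg_start s) - tent r p (seg_end s)) * (tent r q (seg_start s) - tent r q (seg_end s))
      - K\<^sup>2 * mass K s * (tent r p (seg_start s) * tent r q (seg_start s) + tent r p (seg_end s) * tent r q (seg_end s)) = 0"
      using \<open>s \<in> segments\<close> by (auto simp: ball_segments_def)
  qed
  have mean_pos: "0 < mean (mass K) (tent r z)" if "?Q (tent r z) (tent r z) < 0" for z
  proof -
    have nn: "0 \<le> mass K s * (tent r z (seg_start s) + tent r z (seg_end s))" if "s \<in> segments" for s
      using mass_pos[OF _ that, of K] K tent_nonneg by (intro mult_nonneg_nonneg add_nonneg_nonneg) auto
    have "mean (mass K) (tent r z) \<noteq> 0"
    proof
      assume "mean (mass K) (tent r z) = 0"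
      then have "mass K s * (tent r z (seg_start s) + tent r z (seg_end s)) = 0" if "s \<in> segments" for s
        using sum_nonneg_eq_0_iff[of segments "\<lambda>s. mass K s * (tent r z (seg_start s) + tent r z (seg_end s))", OF finite_S nn] that
        unfolding mean_def by blast
      then have "tent r z (seg_start s) + tent r z (seg_end s) = 0" if "s \<in> segments" for s
        using mass_pos[OF _ that, of K] K that by fastforce
      then have "tent r z (seg_start s) = 0 \<and> tent r z (seg_end s) = 0" if "s \<in> segments" for s
        using that tent_nonneg add_nonneg_eq_0_iff by blast
      then have "?Q (tent r z) (tent r z) = 0" unfolding form_def by (intro sum.neutral) auto
      then show False using that by simp
    qed
    moreover have "0 \<le> mean (mass K) (tent r z)" unfolding mean_def by (rule sum_nonneg) (rule nn)
    ultimately show ?thesis by simp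
  qed
  define t where "t = - mean (mass K) (tent r p) / mean (mass K) (tent r q)"
  define \<phi>\<^sub>0 where "\<phi>\<^sub>0 = (\<lambda>w. tent r p w + t * tent r q w)"
  have mean0: "mean (mass K) \<phi>\<^sub>0 = 0"
    unfolding \<phi>\<^sub>0_def mean_add_scaled using mean_pos[OF neg(2)] by (simp add: t_def)
  have Q0: "?Q \<phi>\<^sub>0 \<phi>\<^sub>0 < 0"
    unfolding \<phi>\<^sub>0_def form_quadratic disj
    using neg mult_nonneg_nonpos[OF zero_le_power2[of t], of "?Q (tent r q) (tent r q)"] by simp
  obtain k \<phi> where k: "0 < k" "k < K" and nz: "\<exists>w\<in>nodes. \<phi> w \<noteq> 0"
    and fl: "\<And>w. w \<in> nodes \<Longrightarrow> osc_flux k \<phi> w = 0"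
    and least: "\<And>k' \<phi>'. \<lbrakk>0 < k'; k' < k; \<And>w. w \<in> nodes \<Longrightarrow> osc_flux k' \<phi>' w = 0\<rbrakk> \<Longrightarrow> \<forall>w\<in>nodes. \<phi>' w = 0"
  proof (rule least_critical_frequency[where p = stiffness and m = mass and K = K and \<phi>\<^sub>0 = \<phi>\<^sub>0])
    show "continuous_on {0..K} (\<lambda>k. stiffness k s)" "continuous_on {0..K} (\<lambda>k. mass k s)" if "s \<in> segments" for s
      using that by (rule continuous_stiffness continuous_mass)+
    show "0 < stiffness k s" "0 < mass k s" if "k \<in> {0..K}" "s \<in> segments" for k s
      using that by (rule stiffness_pos mass_pos)+
    show "0 < K" "mean (mass K) \<phi>\<^sub>0 = 0" "?Q \<phi>\<^sub>0 \<phi>\<^sub>0 < 0" by (fact K mean0 Q0)+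
    fix k \<phi>
    assume a: "0 < k" "k < K" "\<exists>w\<in>nodes. \<phi> w \<noteq> 0"
      and b: "\<And>w. w \<in> nodes \<Longrightarrow> osc_flux k \<phi> w = 0"
      and c: "\<And>k' \<phi>'. \<lbrakk>0 < k'; k' < k; \<And>w. w \<in> nodes \<Longrightarrow> osc_flux k' \<phi>' w = 0\<rbrakk> \<Longrightarrow> \<forall>w\<in>nodes. \<phi>' w = 0"
    show thesis by (rule that[OF a]) (fact b c)+
  qed
  have step: "k' * (len e / real n) \<le> 1" if "e \<in> arcs G" "0 < k'" "k' < K" for k' e
    using K_seg_le(2)[of "(e, 0)" k'] that n_pos by (simp add: segments_def seg_len_def)
  have "k\<^sup>2 \<in> eigenvalues G len"
    by (rule eigenvalue_of_flux_eq_0[OF k(1) _ fl nz]) (use step k in auto)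
  moreover have "k\<^sup>2 \<le> \<nu>" if \<nu>: "\<nu> \<in> eigenvalues G len" "0 < \<nu>" for \<nu>
  proof (rule ccontr)
    assume "\<not> k\<^sup>2 \<le> \<nu>"
    define k' where "k' = sqrt \<nu>"
    have k': "0 < k'" "k'\<^sup>2 = \<nu>" using \<nu>(2) by (auto simp: k'_def)
    have "k' < k" using \<open>\<not> k\<^sup>2 \<le> \<nu>\<close> k k' by (metis less_imp_le not_le power_mono)
    obtain \<phi>' where "\<And>w. w \<in> nodes \<Longrightarrow> osc_flux k' \<phi>' w = 0" "\<exists>w\<in>nodes. \<phi>' w \<noteq> 0"
      by (rule flux_eq_0_of_eigenvalue[of k']) (use step \<nu> k k' \<open>k' < k\<close> in auto)
    then show False using least[OF k'(1) \<open>k' < k\<close>] by blast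
  qed
  moreover have "k\<^sup>2 < K\<^sup>2" using k by (intro power_strict_mono) auto
  ultimately show thesis using that[of "k\<^sup>2"] k(1) by simp
qed

end

lemma ball_lengths_sum_le:
  assumes "p \<in> points G len" "q \<in> points G len" "z \<in> points G len"
    and "2 * r + \<delta> \<le> dist\<^sub>G p q" "2 * r + \<delta> \<le> dist\<^sub>G p z" "2 * r + \<delta> \<le> dist\<^sub>G q z"
  shows "ball_length r p + ball_length r q + ball_length r z \<le> total_length G len"
proof -
  note d = balls_disjoint[OF assms(1,2,4)] balls_disjoint[OF assms(1,3,5)] balls_disjoint[OF assms(2,3,6)]
  have fin: "finite (ball_segments r x)" for x using finite_S by (simp add: ball_segments_def)
  have "ball_length r p + ball_length r q + ball_length r z
      = (\<Sum>s\<in>ball_segments r p \<union> ball_segments r q \<union> ball_segments r z. seg_len s)"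
    unfolding ball_length_def using d fin
    by (subst sum.union_disjoint, auto)+
  also have "\<dots> \<le> (\<Sum>s\<in>segments. seg_len s)"
    using finite_S seg_len_pos by (intro sum_mono2) (auto simp: ball_segments_def less_imp_le)
  finally show ?thesis by (simp add: sum_seg_len)
qed

end

end

context connected_metric_graph
begin

text \<open>
  Among three disjoint balls, each of length at least \<open>r - \<delta>\<close> and together of length at most \<open>L\<close>, at
  most one is longer than \<open>(L - (r - \<delta>)) / 2\<close>. The length of the third ball is what makes the final
  inequality strict.
\<close>

lemma second_eigenvalue_less:
  assumes \<delta>: "0 < \<delta>" "4 * \<delta> \<le> triameter G len" and K: "0 < K" "K * \<delta> \<le> 1"
    and small: "(total_length G len - (triameter G len / 2 - 2 * \<delta>)) / 2
        < cos (K * \<delta>) * K\<^sup>2 * (triameter G len / 2 - 2 * \<delta>) ^ 3 / 3"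
  shows "nth_eigenvalue G len 2 < K\<^sup>2"
proof -
  define r where "r = triameter G len / 2 - \<delta>"
  have r: "\<delta> \<le> r" "r - \<delta> = triameter G len / 2 - 2 * \<delta>" using \<delta> by (auto simp: r_def)
  \<comment> \<open>fine enough that no segment is longer than \<open>\<delta>\<close>\<close>
  define n where "n = Suc (nat \<lceil>Max (len ` arcs G) / \<delta>\<rceil>)"
  have n: "0 < n" by (simp add: n_def)
  have mesh: "len e / real n \<le> \<delta>" if "e \<in> arcs G" for e
  proof -
    have "len e / \<delta> \<le> Max (len ` arcs G) / \<delta>" using that \<delta> by (intro divide_right_mono Max_ge) auto
    also have "\<dots> \<le> real n" unfolding n_def by linarith
    finally show ?thesis using \<delta> n by (simp add: field_simps)
  qed
  interpret subdivided_graph G len n by unfold_locales (rule n)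
  obtain x y z where pts: "x \<in> points G len" "y \<in> points G len" "z \<in> points G len"
    and far: "triameter G len - \<delta> < dist\<^sub>G x y" "triameter G len - \<delta> < dist\<^sub>G x z" "triameter G len - \<delta> < dist\<^sub>G y z"
    using triameter_approx[of "triameter G len - \<delta>"] \<delta> by auto
  have far': "2 * r + \<delta> \<le> dist\<^sub>G x y" "2 * r + \<delta> \<le> dist\<^sub>G x z" "2 * r + \<delta> \<le> dist\<^sub>G y z"
    using far by (auto simp: r_def)
  have r0: "0 \<le> r" using r \<delta> by linarith
  let ?b = "\<lambda>p. ball_length r p" and ?m = "(total_length G len - (r - \<delta>)) / 2"
  have m2: "2 * ?m = total_length G len - (r - \<delta>)" by simp
  have sum: "?b x + ?b y + ?b z \<le> total_length G len"
    by (rule ball_lengths_sum_le[OF mesh]) (use pts far' in auto)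
  have bx: "r - \<delta> \<le> ?b x"
    by (rule ball_length_ge[OF mesh pts(1,2)]) (use r r0 far' in \<open>auto simp: graph_dist_commute[of y x]\<close>)
  have by': "r - \<delta> \<le> ?b y"
    by (rule ball_length_ge[OF mesh pts(2,1)]) (use r r0 far' in auto)
  have bz: "r - \<delta> \<le> ?b z"
    by (rule ball_length_ge[OF mesh pts(3,1)]) (use r r0 far' in auto)
  have "?b x \<le> ?m" if "?m < ?b y" using sum bz that m2 by argo
  moreover have "?b x \<le> ?m" if "?m < ?b z" using sum by' that m2 by argo
  moreover have "?b y \<le> ?m" if "?m < ?b z" using sum bx that m2 by argo
  ultimately have "?b x \<le> ?m \<and> ?b y \<le> ?m \<or> ?b x \<le> ?m \<and> ?b z \<le> ?m \<or> ?b y \<le> ?m \<and> ?b z \<le> ?m"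
    using linorder_not_less by blast
  then obtain p q where pq: "p \<in> points G len" "q \<in> points G len" "2 * r + \<delta> \<le> dist\<^sub>G p q" "?b p \<le> ?m" "?b q \<le> ?m"
    using pts far' by blast
  have m: "?m < cos (K * \<delta>) * K\<^sup>2 * (r - \<delta>) ^ 3 / 3" using small by (simp add: r(2))
  obtain \<mu> where "\<mu> \<in> eigenvalues G len" "0 < \<mu>" "\<mu> < K\<^sup>2"
    "\<And>\<nu>. \<nu> \<in> eigenvalues G len \<Longrightarrow> 0 < \<nu> \<Longrightarrow> \<mu> \<le> \<nu>"
    by (rule least_positive_eigenvalue_below[OF mesh K pq(1-3) r(1)]) (use pq m in auto)
  then show ?thesis using second_eigenvalue_le[of \<mu>] by force
qed

end

section \<open>The bound on the spectral gap\<close>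

theorem theorem1p11:
  fixes G :: "('v, 'e) pre_digraph" and len :: "'e \<Rightarrow> real" and T L :: real
  assumes "compact_metric_graph G len"
    and "Digraph_Component.connected G"
    and "T = triameter G len"
    and "L = total_length G len"
  shows "nth_eigenvalue G len 2 < 12 * L / T ^ 3"
proof -
  interpret connected_metric_graph G len
    using assms(1,2) by (intro connected_metric_graph.intro connected_metric_graph_axioms.intro)
  have T: "0 < T" unfolding assms(3) by (rule triameter_pos)
  have L: "0 < L"
    unfolding assms(4) total_length_def using arcs_nonempty len_pos by (intro sum_pos) auto
  define K where "K = sqrt (12 * L / T ^ 3)"
  have K: "0 < K" "K\<^sup>2 = 12 * L / T ^ 3" using T L by (auto simp: K_def)
  let ?gap = "\<lambda>\<delta>. cos (K * \<delta>) * K\<^sup>2 * (T / 2 - 2 * \<delta>) ^ 3 / 3 - (L - (T / 2 - 2 * \<delta>)) / 2"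
  \<comment> \<open>in the limit \<open>\<delta> \<rightarrow> 0\<close> the required inequality reads \<open>(L - T / 2) / 2 < L / 2\<close>\<close>
  have "(?gap \<longlongrightarrow> ?gap 0) (at_right 0)" by (intro tendsto_intros) auto
  moreover have "cos (K * 0) * K\<^sup>2 * (T / 2 - 2 * 0) ^ 3 / 3 = L / 2"
    using T by (simp add: K(2) power_divide)
  then have "0 < ?gap 0" using T by simp
  ultimately have lim: "eventually (\<lambda>\<delta>. 0 < ?gap \<delta>) (at_right 0)" by (rule order_tendstoD(1))
  have "0 < min (T / 4) (1 / K)" using T K by simp
  then have "eventually (\<lambda>\<delta>. \<delta> \<in> {0<..<min (T / 4) (1 / K)}) (at_right 0)" by (rule eventually_at_right_real)
  then have "eventually (\<lambda>\<delta>. \<delta> \<in> {0<..<min (T / 4) (1 / K)} \<and> 0 < ?gap \<delta>) (at_right 0)"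
    using lim by (rule eventually_conj)
  then obtain \<delta> where \<delta>: "\<delta> \<in> {0<..<min (T / 4) (1 / K)}" "0 < ?gap \<delta>"
    using eventually_happens'[OF trivial_limit_at_right_real] by blast
  have "nth_eigenvalue G len 2 < K\<^sup>2"
    by (rule second_eigenvalue_less[of \<delta> K])
      (use \<delta> K(1) in \<open>auto simp: assms(3,4)[symmetric] field_simps\<close>)
  then show ?thesis by (simp add: K(2))
qed

end
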